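(* Let $p\in(0,1)$ be a constant and let $G=G_p\in\mathcal{G}_{n,p}$ be a random graph. Let $HW(G)$ be the hyper-Wiener matrix of $G$, with $(i,j)$-entry $\frac12\big(D(i,j)+D(i,j)^2\big)$. Then $$\mathscr{E}(HW(G))=\Big(\frac{16}{3\pi}\sqrt{p(1-p)}+o(1)\Big)n^{3/2}\quad\text{a.s.}$$
   Context: $D(i,j)$ is the distance between vertices $i$ and $j$ in $G$ (so $D(i,i)=0$). The energy of a real symmetric matrix $M$ with eigenvalues $\lambda_1,\dots,\lambda_n$ is $\mathscr{E}(M)=\sum_{i=1}^n|\lambda_i|$. $\mathcal{G}_{n,p}$ is the Erdős–Rényi random graph model on $n$ vertices, each edge chosen independently with probability $p$. "a.s." means with probability tending to $1$ as $n\to\infty$; the $o(1)$ term is bounded in absolute value by a deterministic sequence tending to $0$ with probability tending to $1$. (With probability tending to $1$ the graph is connected with diameter $2$, so the convention for distances in disconnected graphs is irrelevant.) *)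

theory Defs
  imports "HOL-Probability.Probability" "Jordan_Normal_Form.Char_Poly"
begin

(* A simple graph on the vertex set {..<n} is given by its set of edges; an edge is a
   two-element set of vertices.  The order n of the graph is passed separately. *)

definition all_edges :: "nat \<Rightarrow> nat set set" where
  "all_edges n = {e. e \<subseteq> {..<n} \<and> card e = 2}"

definition erdos_renyi :: "nat \<Rightarrow> real \<Rightarrow> nat set set pmf" where
  "erdos_renyi n p =
     map_pmf (\<lambda>f. {e \<in> all_edges n. f e}) (Pi_pmf (all_edges n) False (\<lambda>_. bernoulli_pmf p))"

definition adj_rel :: "nat set set \<Rightarrow> (nat \<times> nat) set" where
  "adj_rel E = {(i, j). {i, j} \<in> E}"

(* (i, j) \<in> adj_rel E ^^ k says that there is a walk of length k from i to j.  Vertices in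
   different components get distance 0 by convention. *)
definition graph_dist :: "nat set set \<Rightarrow> nat \<Rightarrow> nat \<Rightarrow> nat" where
  "graph_dist E i j =
     (if \<exists>k. (i, j) \<in> adj_rel E ^^ k then LEAST k. (i, j) \<in> adj_rel E ^^ k else 0)"

definition hyper_wiener_mat :: "nat \<Rightarrow> nat set set \<Rightarrow> real mat" where
  "hyper_wiener_mat n E =
     mat n n (\<lambda>(i, j). (real (graph_dist E i j) + (real (graph_dist E i j))\<^sup>2) / 2)"

(* Eigenvalues are counted with their multiplicity as roots of the characteristic polynomial.
   Only meant for symmetric M, where all complex eigenvalues are real. *)
definition mat_energy :: "real mat \<Rightarrow> real" where
  "mat_energy M =
     (\<Sum>x | eigenvalue M x. real (Polynomial.order x (char_poly M)) * \<bar>x\<bar>)"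

(* "P holds a.s." for G in the random graph model on n vertices, in the sense of random graph
   theory: with probability tending to 1 as n tends to infinity. *)
definition holds_as :: "real \<Rightarrow> (nat \<Rightarrow> nat set set \<Rightarrow> bool) \<Rightarrow> bool" where
  "holds_as p P \<longleftrightarrow>
     (\<lambda>n. measure_pmf.prob (erdos_renyi n p) {E. P n E}) \<longlonglongrightarrow> 1"

end

theory Submission
  imports Defs "Jordan_Normal_Form.Schur_Decomposition" "HOL-Real_Asymp.Real_Asymp"
begin

text \<open>
  With probability tending to \<open>1\<close> any two vertices of the random graph have a common neighbour.
  Distances are then \<open>1\<close> along edges and \<open>2\<close> otherwise, so the hyper-Wiener matrix has the entry
  \<open>1\<close> at an edge, \<open>3\<close> at a non-edge and \<open>0\<close> on the diagonal. Up to the factor \<open>sqrt n\<close> it is a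
  Wigner matrix (\<open>scaled_mat\<close>) with independent entries of variance \<open>v / n\<close>, where
  \<open>v = 4 p (1 - p)\<close>, and of mean \<open>(3 - 2 p) / sqrt n\<close>. Its energy is governed by the semicircle law,
  whose first absolute moment at variance \<open>v\<close> is \<open>8 sqrt v / (3 pi)\<close>.

  The energy is reached through resolvents. Coulson's integral
  \<open>\<bar>x\<bar> = 2 / pi * \<integral> x\<^sup>2 / (x\<^sup>2 + t\<^sup>2) dt\<close> over \<open>t \<ge> 0\<close> expresses the mean absolute eigenvalue of the scaled
  matrix as \<open>2 / pi\<close> times the integral of \<open>1 - t Im s\<close>, where \<open>s\<close> is the normalised trace of the
  resolvent at the point \<open>\<i> t\<close>. The mean of the squared eigenvalues is at most \<open>9\<close>, so the integrand is
  bounded by the integrable function \<open>9 / (9 + t\<^sup>2)\<close> for every graph, and dominated convergence reduces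
  the claim to the convergence of \<open>s\<close> in \<open>L\<^sup>1\<close> for each fixed \<open>t > 0\<close>
  (\<open>mean_abs_eigenvalue_L1_limit\<close>).

  For that, let \<open>P = 1 + \<i> t s + v s\<^sup>2\<close> (\<open>defect\<close>); the semicircle law corresponds to \<open>P = 0\<close>.
  Redrawing a single edge gives a discrete integration by parts
  (\<open>edge_integration_by_parts\<close>), and applied to every entry of the matrix it yields
  \<open>E[P F] = O(1 / sqrt n)\<close> for each bounded function \<open>F\<close> of the graph that changes by at most \<open>O(1 / n)\<close>
  when one edge changes (\<open>loop_equation\<close>). The nonzero mean of the entries enters only through the
  sum of the off-diagonal entries of the resolvent, which is at most \<open>2 n / t\<close> in modulus, and so stays
  inside the error term.
  The function \<open>F = cnj P\<close> is admissible, hence \<open>E \<bar>P\<bar>\<^sup>2 = O(1 / sqrt n)\<close>: the equation holds in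
  mean square and not only on average. The quadratic has a single root in the upper half plane,
  where \<open>s\<close> lies, and that root is stable (\<open>semicircle_root_stability\<close>), so \<open>s\<close> converges to it. The
  limiting integrand has an elementary antiderivative, with integral \<open>4 sqrt v / 3\<close>; this gives the constant
  \<open>2 / pi * 4 / 3 * 2 sqrt (p (1 - p)) = 16 / (3 pi) * sqrt (p (1 - p))\<close>.
\<close>

section \<open>Spectral theorem for real symmetric matrices\<close>

text \<open>
  A root \<open>a\<close> of the characteristic polynomial exists over the complex numbers. If \<open>v\<close> is an eigenvector
  for it, the Hermitian form of \<open>A\<close> at \<open>v\<close> equals \<open>a\<close> times the squared norm of \<open>v\<close>, and it is its own
  conjugate because \<open>A\<close> is real and symmetric. So \<open>a\<close> is real, and a root of the real polynomial.
\<close>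
lemma symmetric_mat_real_eigenvalue:
  fixes A :: "real mat"
  assumes A: "A \<in> carrier_mat n n" and n: "n > 0" and sym: "\<And>i j. i < n \<Longrightarrow> j < n \<Longrightarrow> A $$ (i,j) = A $$ (j,i)"
  shows "\<exists>e. eigenvalue A e"
proof -
  define C where "C = map_mat complex_of_real A"
  have C: "C \<in> carrier_mat n n" using A by (simp add: C_def)
  obtain as where as: "char_poly C = (\<Prod>a\<leftarrow>as. [:- a, 1:])" "length as = n"
    using char_poly_factorized[OF C] by blast
  then obtain a where "a \<in> set as" using n by (cases as) auto
  then have "poly (char_poly C) a = 0" unfolding as(1) by (auto simp: poly_prod_list prod_list_zero_iff)
  then have "eigenvalue C a" using eigenvalue_root_char_poly[OF C] by simp
  then obtain v where v: "v \<in> carrier_vec n" "v \<noteq> 0\<^sub>v n" "C *\<^sub>v v = a \<cdot>\<^sub>v v"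
    unfolding eigenvalue_def eigenvector_def using C by auto
  have ev: "(\<Sum>j<n. of_real (A $$ (i,j)) * v $ j) = a * v $ i" if "i < n" for i
  proof -
    have "(C *\<^sub>v v) $ i = (\<Sum>j<n. of_real (A $$ (i,j)) * v $ j)"
      using that v(1) A C by (auto simp: C_def scalar_prod_def atLeast0LessThan intro!: sum.cong)
    then show ?thesis using v(1,3) that by auto
  qed
  define S where "S = (\<Sum>i<n. \<Sum>j<n. cnj (v $ i) * of_real (A $$ (i,j)) * v $ j)"
  have "cnj S = (\<Sum>i<n. \<Sum>j<n. v $ i * of_real (A $$ (i,j)) * cnj (v $ j))"
    unfolding S_def by simp
  also have "\<dots> = (\<Sum>j<n. \<Sum>i<n. v $ i * of_real (A $$ (i,j)) * cnj (v $ j))"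
    by (rule sum.swap)
  also have "\<dots> = S" unfolding S_def by (intro sum.cong) (auto simp: sym mult_ac)
  finally have Sreal: "Im S = 0" by (metis Im_complex_of_real Reals_cnj_iff complex_is_Real_iff)
  have "S = (\<Sum>i<n. cnj (v $ i) * (\<Sum>j<n. of_real (A $$ (i,j)) * v $ j))"
    unfolding S_def by (simp add: sum_distrib_left mult.assoc)
  also have "\<dots> = (\<Sum>i<n. cnj (v $ i) * (a * v $ i))" by (simp add: ev)
  also have "\<dots> = a * (\<Sum>i<n. of_real ((cmod (v $ i))\<^sup>2))"
    unfolding sum_distrib_left complex_norm_square by (intro sum.cong) (auto simp: mult_ac)
  also have "\<dots> = a * of_real (\<Sum>i<n. (cmod (v $ i))\<^sup>2)" by simp
  finally have "Im a * (\<Sum>i<n. (cmod (v $ i))\<^sup>2) = 0" using Sreal by (simp add: complex_eq_iff)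
  moreover have "(\<Sum>i<n. (cmod (v $ i))\<^sup>2) \<noteq> 0"
  proof
    assume "(\<Sum>i<n. (cmod (v $ i))\<^sup>2) = 0"
    then have "\<forall>i<n. v $ i = 0" by (subst (asm) sum_nonneg_eq_0_iff) auto
    then have "v = 0\<^sub>v n" using v(1) by (intro eq_vecI) auto
    then show False using v(2) by simp
  qed
  ultimately have "Im a = 0" by simp
  then have a: "a = of_real (Re a)" by (simp add: complex_eq_iff)
  have "char_poly C = map_poly complex_of_real (char_poly A)"
    unfolding C_def by (rule of_real_hom.char_poly_hom[OF A])
  with \<open>poly (char_poly C) a = 0\<close> have "poly (char_poly A) (Re a) = 0"
    using a by (metis of_real_hom.poly_map_poly of_real_hom.hom_0_iff)
  then show ?thesis using eigenvalue_root_char_poly[OF A] by blast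
qed

text \<open>
  Gram-Schmidt applied to a basis that starts with \<open>v\<close> leaves \<open>v\<close> in the first place; the resulting
  columns are orthogonal and only have to be normalised.
\<close>
lemma orthogonal_mat_with_first_column:
  fixes v :: "real vec"
  assumes v: "v \<in> carrier_vec n" and v0: "v \<noteq> 0\<^sub>v n" and n: "n > 0"
  shows "\<exists>W c. W \<in> carrier_mat n n \<and> W\<^sup>T * W = 1\<^sub>m n \<and> W * W\<^sup>T = 1\<^sub>m n \<and> col W 0 = c \<cdot>\<^sub>v v"
proof -
  interpret cof_vec_space n "TYPE(real)" .
  define b where "b = basis_completion v"
  define ws where "ws = gram_schmidt n b"
  from basis_completion[OF v v0, folded b_def]
  have span_b: "span (set b) = carrier_vec n" and dist_b: "distinct b"
    and indep: "\<not> lin_dep (set b)" and b: "set b \<subseteq> carrier_vec n" and hdb: "hd b = v"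
    and len_b: "length b = n" by auto
  from hdb len_b n obtain vs where bv: "b = v # vs" by (cases b, auto)
  from gram_schmidt_result[OF b dist_b indep refl, folded ws_def]
  have ws: "set ws \<subseteq> carrier_vec n" "corthogonal ws" "length ws = n"
    by (auto simp: len_b)
  from gram_schmidt_hd[OF v, of vs, folded bv] have hdws: "hd ws = v" unfolding ws_def .
  have wsc: "ws ! i \<in> carrier_vec n" if "i < n" for i using ws that by (metis nth_mem subsetD)
  have orth: "(ws ! i \<bullet> ws ! j = 0) = (i \<noteq> j)" if "i < n" "j < n" for i j
    using corthogonalD[OF ws(2)] that ws(3) by simp
  have pos: "ws ! i \<bullet> ws ! i > 0" if "i < n" for i
  proof -
    have "ws ! i \<bullet> ws ! i \<ge> 0" unfolding scalar_prod_def by (intro sum_nonneg) auto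
    then show ?thesis using orth[OF that that] by linarith
  qed
  \<comment> \<open>The columns are the normalised Gram-Schmidt vectors.\<close>
  define W where "W = mat n n (\<lambda>(i,j). ws ! j $ i / sqrt (ws ! j \<bullet> ws ! j))"
  have W: "W \<in> carrier_mat n n" by (simp add: W_def)
  have WW: "W\<^sup>T * W = 1\<^sub>m n"
  proof (rule eq_matI)
    fix i j assume "i < dim_row (1\<^sub>m n :: real mat)" "j < dim_col (1\<^sub>m n :: real mat)"
    then have ij: "i < n" "j < n" by auto
    have "(W\<^sup>T * W) $$ (i,j) = (\<Sum>k<n. (ws ! i $ k / sqrt (ws ! i \<bullet> ws ! i)) * (ws ! j $ k / sqrt (ws ! j \<bullet> ws ! j)))"
      using ij by (auto simp: W_def scalar_prod_def atLeast0LessThan intro!: sum.cong)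
    also have "\<dots> = (\<Sum>k<n. ws ! i $ k * ws ! j $ k) / (sqrt (ws ! i \<bullet> ws ! i) * sqrt (ws ! j \<bullet> ws ! j))"
      by (simp add: sum_divide_distrib)
    also have "(\<Sum>k<n. ws ! i $ k * ws ! j $ k) = ws ! i \<bullet> ws ! j"
      using wsc[OF ij(2)] by (simp add: scalar_prod_def atLeast0LessThan)
    also have "ws ! i \<bullet> ws ! j / (sqrt (ws ! i \<bullet> ws ! i) * sqrt (ws ! j \<bullet> ws ! j)) = 1\<^sub>m n $$ (i,j)"
      using orth[OF ij] pos[OF ij(1)] ij by (cases "i = j") auto
    finally show "(W\<^sup>T * W) $$ (i,j) = 1\<^sub>m n $$ (i,j)" .
  qed (auto simp: W_def)
  have "W * W\<^sup>T = 1\<^sub>m n" using mat_mult_left_right_inverse[OF _ W WW] W by simp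
  moreover have "col W 0 = (1 / sqrt (ws ! 0 \<bullet> ws ! 0)) \<cdot>\<^sub>v v"
  proof -
    have "ws ! 0 = v" using hdws ws(3) n by (cases ws) auto
    then show ?thesis using v n by (intro eq_vecI) (auto simp: W_def)
  qed
  ultimately show ?thesis using W WW by blast
qed

text \<open>
  Conjugation by an orthogonal matrix whose first column is an eigenvector clears the first column
  off the diagonal, and by symmetry the first row as well. The remaining block is symmetric, of
  dimension one less.
\<close>
theorem real_spectral_theorem:
  fixes A :: "real mat"
  assumes "A \<in> carrier_mat n n" and "A\<^sup>T = A"
  shows "\<exists>U D. U \<in> carrier_mat n n \<and> D \<in> carrier_mat n n \<and> diagonal_mat D \<and>
           U\<^sup>T * U = 1\<^sub>m n \<and> U * U\<^sup>T = 1\<^sub>m n \<and> A = U * D * U\<^sup>T"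
  using assms
proof (induction n arbitrary: A)
  case 0
  then show ?case by (intro exI[of _ "1\<^sub>m 0"]) (auto simp: diagonal_mat_def intro!: eq_matI)
next
  case (Suc n A)
  note A = Suc.prems(1)
  have sym: "A $$ (i,j) = A $$ (j,i)" if "i < Suc n" "j < Suc n" for i j
    using Suc.prems that by (metis carrier_matD index_transpose_mat(1))
  obtain e where "eigenvalue A e" using symmetric_mat_real_eigenvalue[OF A] sym by auto
  then obtain v where v: "v \<in> carrier_vec (Suc n)" "v \<noteq> 0\<^sub>v (Suc n)" "A *\<^sub>v v = e \<cdot>\<^sub>v v"
    unfolding eigenvalue_def eigenvector_def using A by auto
  obtain W c where W: "W \<in> carrier_mat (Suc n) (Suc n)" "W\<^sup>T * W = 1\<^sub>m (Suc n)"
    "W * W\<^sup>T = 1\<^sub>m (Suc n)" "col W 0 = c \<cdot>\<^sub>v v"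
    using orthogonal_mat_with_first_column[OF v(1,2)] by auto
  define B where "B = W\<^sup>T * A * W"
  have WT: "W\<^sup>T \<in> carrier_mat (Suc n) (Suc n)" using W by simp
  have B: "B \<in> carrier_mat (Suc n) (Suc n)" unfolding B_def using W A by simp
  have BT: "B\<^sup>T = B"
  proof -
    have "B\<^sup>T = W\<^sup>T * (W\<^sup>T * A)\<^sup>T" unfolding B_def
      by (rule transpose_mult[of _ "Suc n" "Suc n" _ "Suc n"]) (use W A in auto)
    also have "(W\<^sup>T * A)\<^sup>T = A * W"
      using transpose_mult[OF WT A] Suc.prems(2) by simp
    finally show ?thesis unfolding B_def using assoc_mult_mat[OF WT A W(1)] by simp
  qed
  have symB: "B $$ (i,j) = B $$ (j,i)" if "i < Suc n" "j < Suc n" for i j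
    using BT B that by (metis carrier_matD index_transpose_mat(1))
  have AW: "A = W * B * W\<^sup>T"
  proof -
    have "W * B * W\<^sup>T = W * (W\<^sup>T * (A * W)) * W\<^sup>T" unfolding B_def using assoc_mult_mat[OF WT A W(1)] by simp
    also have "W * (W\<^sup>T * (A * W)) = (W * W\<^sup>T) * (A * W)"
      by (rule assoc_mult_mat[symmetric, of _ "Suc n" "Suc n" _ "Suc n" _ "Suc n"]) (use W A in auto)
    also have "\<dots> * W\<^sup>T = A * (W * W\<^sup>T)"
      using W A assoc_mult_mat[OF A W(1) WT] by simp
    also have "\<dots> = A" using W A by simp
    finally show ?thesis by simp
  qed
  have col0: "B $$ (i,0) = (if i = 0 then e else 0)" if i: "i < Suc n" for i
  proof -
    have "col B 0 = (W\<^sup>T * A) *\<^sub>v col W 0" unfolding B_def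
      by (rule col_mult2[of _ "Suc n" "Suc n" _ "Suc n"]) (use W A in auto)
    also have "\<dots> = W\<^sup>T *\<^sub>v (A *\<^sub>v col W 0)"
      by (rule assoc_mult_mat_vec[of _ "Suc n" "Suc n" _ "Suc n"]) (use W A v in auto)
    also have "A *\<^sub>v col W 0 = c \<cdot>\<^sub>v (A *\<^sub>v v)" unfolding W(4)
      by (rule mult_mat_vec[OF A v(1)])
    also have "\<dots> = e \<cdot>\<^sub>v col W 0" unfolding v(3) W(4) using v(1) by (intro eq_vecI) auto
    also have "W\<^sup>T *\<^sub>v (e \<cdot>\<^sub>v col W 0) = e \<cdot>\<^sub>v (W\<^sup>T *\<^sub>v col W 0)"
      by (rule mult_mat_vec[OF WT]) (use W v(1) in auto)
    also have "W\<^sup>T *\<^sub>v col W 0 = col (W\<^sup>T * W) 0"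
      by (rule col_mult2[symmetric, of _ "Suc n" "Suc n" _ "Suc n"]) (use W in auto)
    finally have "col B 0 $ i = (e \<cdot>\<^sub>v col (1\<^sub>m (Suc n)) 0) $ i" using W(2) by simp
    then show ?thesis using i B by auto
  qed
  define B' where "B' = mat n n (\<lambda>(i,j). B $$ (Suc i, Suc j))"
  have "\<exists>U D. U \<in> carrier_mat n n \<and> D \<in> carrier_mat n n \<and> diagonal_mat D \<and>
           U\<^sup>T * U = 1\<^sub>m n \<and> U * U\<^sup>T = 1\<^sub>m n \<and> B' = U * D * U\<^sup>T"
    by (rule Suc.IH) (auto simp: B'_def symB intro!: eq_matI)
  then obtain U D where U: "U \<in> carrier_mat n n" "U\<^sup>T * U = 1\<^sub>m n" "U * U\<^sup>T = 1\<^sub>m n"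
    and D: "D \<in> carrier_mat n n" "diagonal_mat D" and B'eq: "B' = U * D * U\<^sup>T" by blast
  define E1 where "E1 = mat 1 1 (\<lambda>_. e)"
  have E1: "E1 \<in> carrier_mat 1 1" by (simp add: E1_def)
  have UT: "U\<^sup>T \<in> carrier_mat n n" using U by simp
  define V where "V = four_block_mat (1\<^sub>m 1) (0\<^sub>m 1 n) (0\<^sub>m n 1) U"
  define F where "F = four_block_mat E1 (0\<^sub>m 1 n) (0\<^sub>m n 1) D"
  have V: "V \<in> carrier_mat (Suc n) (Suc n)" unfolding V_def using four_block_carrier_mat[OF one_carrier_mat[of 1] U(1)] by simp
  have F: "F \<in> carrier_mat (Suc n) (Suc n)" unfolding F_def using four_block_carrier_mat[OF E1 D(1)] by simp
  have VT: "V\<^sup>T = four_block_mat (1\<^sub>m 1) (0\<^sub>m 1 n) (0\<^sub>m n 1) (U\<^sup>T)"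
    unfolding V_def using transpose_four_block_mat[of "1\<^sub>m 1 :: real mat" 1 1 "0\<^sub>m 1 n" n "0\<^sub>m n 1" n U] U
    by simp
  have VTc: "V\<^sup>T \<in> carrier_mat (Suc n) (Suc n)" using V by simp
  have mult: "four_block_mat P (0\<^sub>m 1 n) (0\<^sub>m n 1) Q * four_block_mat P' (0\<^sub>m 1 n) (0\<^sub>m n 1) Q'
     = four_block_mat (P * P') (0\<^sub>m 1 n) (0\<^sub>m n 1) (Q * Q')"
    if "P \<in> carrier_mat 1 1" "P' \<in> carrier_mat 1 1" "Q \<in> carrier_mat n n" "Q' \<in> carrier_mat n n"
    for P P' Q Q' :: "real mat"
    using that by (subst mult_four_block_mat[of _ 1 1 _ n _ n _ _ 1 _ n]) auto
  have one: "four_block_mat (1\<^sub>m 1) (0\<^sub>m 1 n) (0\<^sub>m n 1) (1\<^sub>m n) = (1\<^sub>m (Suc n) :: real mat)"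
    by (intro eq_matI) auto
  have VTV: "V\<^sup>T * V = 1\<^sub>m (Suc n)" unfolding VT unfolding V_def using mult[of "1\<^sub>m 1" "1\<^sub>m 1" "U\<^sup>T" U] U one by simp
  have VVT: "V * V\<^sup>T = 1\<^sub>m (Suc n)" unfolding VT unfolding V_def using mult[of "1\<^sub>m 1" "1\<^sub>m 1" U "U\<^sup>T"] U one by simp
  have "B = four_block_mat E1 (0\<^sub>m 1 n) (0\<^sub>m n 1) B'"
  proof (rule eq_matI, goal_cases)
    case (1 i j)
    then have ij: "i < Suc n" "j < Suc n" using E1 by (auto simp: B'_def)
    show ?case
    proof (cases "i = 0 \<or> j = 0")
      case True
      then show ?thesis using ij col0[of i] col0[of j] symB[OF ij] by (auto simp: E1_def B'_def)
    next
      case False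
      then show ?thesis using ij by (auto simp: E1_def B'_def)
    qed
  qed (use B in \<open>auto simp: E1_def B'_def\<close>)
  also have "\<dots> = V * F * V\<^sup>T"
    unfolding VT unfolding V_def F_def B'eq
    using mult[of "1\<^sub>m 1" E1 U D] mult[of E1 "1\<^sub>m 1" "U * D" "U\<^sup>T"] U D E1 by simp
  finally have BV: "B = V * F * V\<^sup>T" .
  have "(W * V)\<^sup>T = V\<^sup>T * W\<^sup>T" by (rule transpose_mult[OF W(1) V])
  note WVT = this
  have q1: "(W * V)\<^sup>T * (W * V) = 1\<^sub>m (Suc n)"
  proof -
    have "(W * V)\<^sup>T * (W * V) = V\<^sup>T * (W\<^sup>T * (W * V))" unfolding WVT
      by (rule assoc_mult_mat[OF VTc WT]) (use W V in auto)
    also have "W\<^sup>T * (W * V) = V" using assoc_mult_mat[OF WT W(1) V] W V by simp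
    finally show ?thesis using VTV by simp
  qed
  have q2: "(W * V) * (W * V)\<^sup>T = 1\<^sub>m (Suc n)"
    using mat_mult_left_right_inverse[OF _ _ q1] W V by auto
  have q3: "A = (W * V) * F * (W * V)\<^sup>T"
  proof -
    have "A = W * (V * F * V\<^sup>T) * W\<^sup>T" using AW BV by simp
    also have "W * (V * F * V\<^sup>T) = W * (V * F) * V\<^sup>T"
      by (rule assoc_mult_mat[symmetric, of _ "Suc n" "Suc n" _ "Suc n" _ "Suc n"]) (use W V F in auto)
    also have "W * (V * F) = W * V * F"
      by (rule assoc_mult_mat[symmetric, of _ "Suc n" "Suc n" _ "Suc n" _ "Suc n"]) (use W V F in auto)
    also have "W * V * F * V\<^sup>T * W\<^sup>T = W * V * F * (V\<^sup>T * W\<^sup>T)"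
      by (rule assoc_mult_mat[of _ "Suc n" "Suc n" _ "Suc n" _ "Suc n"]) (use W V F in auto)
    finally show ?thesis unfolding WVT .
  qed
  have "diagonal_mat F" using D E1 unfolding F_def diagonal_mat_def
    by (auto simp: E1_def)
  with q1 q2 q3 F show ?case
    by (intro exI[of _ "W * V"] exI[of _ F]) (use W(1) V in \<open>simp add: mult_carrier_mat\<close>)
qed

text \<open>
  The spectral decomposition in terms of functions on indices below \<open>n\<close>, which avoids the carrier
  conditions of matrices: \<open>u 0, \<dots>, u (n - 1)\<close> are orthonormal eigenvectors of \<open>M\<close>. Completeness and
  orthonormality say the same for a square matrix, but the later sums call for both forms.
\<close>
definition eigensystem :: "nat \<Rightarrow> (nat \<Rightarrow> nat \<Rightarrow> real) \<Rightarrow> (nat \<Rightarrow> real) \<Rightarrow> (nat \<Rightarrow> nat \<Rightarrow> real) \<Rightarrow> bool" where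
  "eigensystem n M lam u \<longleftrightarrow>
     (\<forall>i<n. \<forall>j<n. (\<Sum>k<n. u k i * u k j) = of_bool (i = j)) \<and>
     (\<forall>k<n. \<forall>l<n. (\<Sum>i<n. u k i * u l i) = of_bool (k = l)) \<and>
     (\<forall>i<n. \<forall>j<n. M i j = (\<Sum>k<n. lam k * u k i * u k j))"

lemma mult_transpose_entry:
  assumes "X \<in> carrier_mat n n" "Y \<in> carrier_mat n n" "i < n" "j < n"
  shows "(X * Y\<^sup>T) $$ (i,j) = (\<Sum>k<n. X $$ (i,k) * Y $$ (j,k))"
  using assms by (auto simp: scalar_prod_def atLeast0LessThan)

lemma eigensystem_exists:
  assumes "\<And>i j. i < n \<Longrightarrow> j < n \<Longrightarrow> M i j = M j i"
  shows "\<exists>lam u. eigensystem n M lam u"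
proof -
  define A where "A = mat n n (\<lambda>(i,j). M i j)"
  have A: "A \<in> carrier_mat n n" "A\<^sup>T = A" using assms by (auto simp: A_def intro!: eq_matI)
  obtain U D where U: "U \<in> carrier_mat n n" "U\<^sup>T * U = 1\<^sub>m n" "U * U\<^sup>T = 1\<^sub>m n"
    and D: "D \<in> carrier_mat n n" "diagonal_mat D" and eq: "A = U * D * U\<^sup>T"
    using real_spectral_theorem[OF A] by blast
  have 1: "(\<Sum>k<n. U $$ (i,k) * U $$ (j,k)) = of_bool (i = j)" if "i < n" "j < n" for i j
  proof -
    have "(U * U\<^sup>T) $$ (i,j) = (\<Sum>k<n. U $$ (i,k) * U $$ (j,k))"
      using that U(1) by (auto simp: scalar_prod_def atLeast0LessThan)
    moreover have "(U * U\<^sup>T) $$ (i,j) = of_bool (i = j)" using U(3) that by simp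
    ultimately show ?thesis by (rule trans[OF sym])
  qed
  have 2: "(\<Sum>i<n. U $$ (i,k) * U $$ (i,l)) = of_bool (k = l)" if "k < n" "l < n" for k l
  proof -
    have "(U\<^sup>T * U) $$ (k,l) = (\<Sum>i<n. U $$ (i,k) * U $$ (i,l))"
      using that U(1) by (auto simp: scalar_prod_def atLeast0LessThan)
    moreover have "(U\<^sup>T * U) $$ (k,l) = of_bool (k = l)" using U(2) that by simp
    ultimately show ?thesis by (rule trans[OF sym])
  qed
  have 3: "M i j = (\<Sum>k<n. D $$ (k,k) * U $$ (i,k) * U $$ (j,k))" if "i < n" "j < n" for i j
  proof -
    have UD: "(U * D) $$ (i,k) = U $$ (i,k) * D $$ (k,k)" if k: "k < n" for k
    proof -
      have "(U * D) $$ (i,k) = (\<Sum>l<n. U $$ (i,l) * D $$ (l,k))"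
        using that k \<open>i < n\<close> U(1) D(1) by (auto simp: scalar_prod_def atLeast0LessThan)
      also have "\<dots> = (\<Sum>l<n. if l = k then U $$ (i,k) * D $$ (k,k) else 0)"
        using D k unfolding diagonal_mat_def by (intro sum.cong) auto
      finally show ?thesis using k by simp
    qed
    have "M i j = A $$ (i,j)" using that by (simp add: A_def)
    also have "\<dots> = (U * D * U\<^sup>T) $$ (i,j)" by (simp only: eq)
    also have "\<dots> = (\<Sum>k<n. (U * D) $$ (i,k) * U $$ (j,k))"
      using that U(1) D(1) by (intro mult_transpose_entry) auto
    finally show ?thesis using UD by (simp add: mult_ac)
  qed
  show ?thesis unfolding eigensystem_def
    by (rule exI[of _ "\<lambda>k. D $$ (k,k)"], rule exI[of _ "\<lambda>k i. U $$ (i,k)"]) (use 1 2 3 in auto)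
qed

lemma order_prod_linear_factors:
  fixes lam :: "nat \<Rightarrow> real"
  shows "Polynomial.order x (\<Prod>k<n. [:- lam k, 1:]) = card {k. k < n \<and> lam k = x}"
proof (induction n)
  case (Suc n)
  have "{k. k < Suc n \<and> lam k = x} = {k. k < n \<and> lam k = x} \<union> (if lam n = x then {n} else {})"
    by (auto simp: less_Suc_eq)
  then have "card {k. k < Suc n \<and> lam k = x} = card {k. k < n \<and> lam k = x} + (if lam n = x then 1 else 0)"
    by simp
  moreover have "Polynomial.order x [:- lam n, 1:] = (if lam n = x then 1 else 0)"
  proof (cases "lam n = x")
    case True
    then show ?thesis using order_power_n_n[of x 1] by simp
  next
    case False
    then show ?thesis by (simp add: order_0I)
  qed
  moreover have "(\<Prod>k<Suc n. [:- lam k, 1:]) \<noteq> 0" by (subst prod_zero_iff) auto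
  ultimately show ?case using Suc unfolding prod.lessThan_Suc by (subst order_mult) (simp_all del: mult_pCons_right mult_pCons_left)
qed auto

text \<open>
  The order of \<open>x\<close> as a root of the characteristic polynomial counts the indices \<open>k\<close> with \<open>lam k = x\<close>,
  so the sum over distinct eigenvalues can be regrouped as a sum over indices.
\<close>
lemma mat_energy_eigensystem:
  assumes "eigensystem n M lam u"
  shows "mat_energy (mat n n (\<lambda>(i,j). M i j)) = (\<Sum>k<n. \<bar>lam k\<bar>)"
proof -
  define A where "A = mat n n (\<lambda>(i,j). M i j)"
  define D where "D = mat n n (\<lambda>(i,j). if i = j then lam i else 0)"
  define U where "U = mat n n (\<lambda>(i,k). u k i)"
  have A: "A \<in> carrier_mat n n" and D: "D \<in> carrier_mat n n" and U: "U \<in> carrier_mat n n"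
    by (auto simp: A_def D_def U_def)
  have UT: "U\<^sup>T \<in> carrier_mat n n" using U by simp
  have 1: "U * U\<^sup>T = 1\<^sub>m n"
    using assms by (intro eq_matI) (auto simp: U_def scalar_prod_def atLeast0LessThan eigensystem_def)
  have 2: "U\<^sup>T * U = 1\<^sub>m n"
    using assms by (intro eq_matI) (auto simp: U_def scalar_prod_def atLeast0LessThan eigensystem_def)
  have UD: "(U * D) $$ (i,k) = u k i * lam k" if "i < n" "k < n" for i k
  proof -
    have "(U * D) $$ (i,k) = (\<Sum>l<n. u l i * (if l = k then lam l else 0))"
      using that by (auto simp: U_def D_def scalar_prod_def atLeast0LessThan)
    also have "\<dots> = (\<Sum>l<n. if l = k then u k i * lam k else 0)" by (intro sum.cong) auto
    finally show ?thesis using that by simp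
  qed
  have 3: "A = U * D * U\<^sup>T"
  proof (rule eq_matI, goal_cases)
    case (1 i j)
    then have ij: "i < n" "j < n" using U by auto
    have "(U * D * U\<^sup>T) $$ (i,j) = (\<Sum>k<n. (U * D) $$ (i,k) * U $$ (j,k))"
      using ij U D by (intro mult_transpose_entry) auto
    also have "\<dots> = (\<Sum>k<n. (U * D) $$ (i,k) * u k j)"
      using ij by (intro sum.cong) (auto simp: U_def)
    also have "\<dots> = M i j" using UD assms ij by (auto simp: eigensystem_def mult_ac)
    finally show ?case using ij by (simp add: A_def)
  qed (use U in \<open>auto simp: A_def\<close>)
  have "similar_mat A D" unfolding similar_mat_def
    by (intro exI, rule similar_mat_witI[OF 1 2 3 A D U UT])
  then have "char_poly A = char_poly D" by (rule char_poly_similar)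
  also have "\<dots> = (\<Prod>a\<leftarrow>diag_mat D. [:- a, 1:])"
    by (rule char_poly_upper_triangular[OF D]) (auto simp: D_def)
  also have "diag_mat D = map lam [0..<n]" unfolding diag_mat_def by (auto simp: D_def)
  also have "(\<Prod>a\<leftarrow>map lam [0..<n]. [:- a, 1:]) = (\<Prod>k<n. [:- lam k, 1:])"
    by (simp add: prod.list_conv_set_nth atLeast0LessThan)
  finally have cp: "char_poly A = (\<Prod>k<n. [:- lam k, 1:])" .
  have ev: "eigenvalue A x \<longleftrightarrow> x \<in> lam ` {..<n}" for x
    unfolding eigenvalue_root_char_poly[OF A] cp by (auto simp: poly_prod)
  have "mat_energy A = (\<Sum>x\<in>lam ` {..<n}. real (card {k. k < n \<and> lam k = x}) * \<bar>x\<bar>)"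
    unfolding mat_energy_def ev cp order_prod_linear_factors by simp
  also have "\<dots> = (\<Sum>x\<in>lam ` {..<n}. \<Sum>k\<in>{k. k < n \<and> lam k = x}. \<bar>lam k\<bar>)"
    by (intro sum.cong) auto
  also have "\<dots> = (\<Sum>x\<in>lam ` {..<n}. \<Sum>k\<in>{k \<in> {..<n}. lam k = x}. \<bar>lam k\<bar>)"
    by simp
  also have "\<dots> = (\<Sum>k<n. \<bar>lam k\<bar>)" by (rule sum.group) auto
  finally show ?thesis unfolding A_def .
qed

section \<open>Resolvents on the imaginary axis\<close>

text \<open>
  Entry \<open>(i, j)\<close> of the inverse of \<open>M - \<i> t\<close>, where \<open>lam\<close> and \<open>u\<close> form an eigensystem of \<open>M\<close>. Off the
  real axis this inverse exists and has norm at most \<open>1 / t\<close>, whatever the eigenvalues are.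
\<close>
definition resolvent :: "nat \<Rightarrow> (nat \<Rightarrow> real) \<Rightarrow> (nat \<Rightarrow> nat \<Rightarrow> real) \<Rightarrow> real \<Rightarrow> nat \<Rightarrow> nat \<Rightarrow> complex" where
  "resolvent n lam u t i j = (\<Sum>k<n. of_real (u k i * u k j) / (of_real (lam k) - \<i> * of_real t))"

lemma resolvent_sym: "resolvent n lam u t i j = resolvent n lam u t j i"
  by (simp add: resolvent_def mult.commute)

lemma eigensystem_sym:
  assumes "eigensystem n M lam u" "i < n" "j < n"
  shows "M i j = M j i"
  using assms by (auto simp: eigensystem_def mult_ac)

lemma eigensystem_complete:
  "eigensystem n M lam u \<Longrightarrow> i < n \<Longrightarrow> j < n \<Longrightarrow> (\<Sum>k<n. u k i * u k j) = of_bool (i = j)"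
  by (simp add: eigensystem_def)

lemma eigensystem_orthonormal:
  "eigensystem n M lam u \<Longrightarrow> k < n \<Longrightarrow> l < n \<Longrightarrow> (\<Sum>i<n. u k i * u l i) = of_bool (k = l)"
  by (simp add: eigensystem_def)

lemma eigensystem_eigenvector:
  assumes "eigensystem n M lam u" "i < n" "k < n"
  shows "(\<Sum>j<n. M i j * u k j) = lam k * u k i"
proof -
  have "(\<Sum>j<n. M i j * u k j) = (\<Sum>j<n. \<Sum>l<n. lam l * u l i * u l j * u k j)"
    using assms by (intro sum.cong) (auto simp: eigensystem_def sum_distrib_right)
  also have "\<dots> = (\<Sum>l<n. lam l * u l i * (\<Sum>j<n. u l j * u k j))"
    by (subst sum.swap) (simp add: sum_distrib_left mult_ac)
  also have "\<dots> = (\<Sum>l<n. if l = k then lam k * u k i else 0)"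
    using assms by (intro sum.cong) (auto simp: eigensystem_def)
  finally show ?thesis using assms by simp
qed

lemma shifted_nonzero: "t \<noteq> 0 \<Longrightarrow> complex_of_real x - \<i> * of_real t \<noteq> 0"
  by (simp add: complex_eq_iff)

lemma norm_inverse_shifted_le:
  assumes "t > 0"
  shows "norm (1 / (complex_of_real x - \<i> * of_real t)) \<le> 1 / t"
proof -
  have "t = \<bar>Im (complex_of_real x - \<i> * of_real t)\<bar>" using assms by simp
  also have "\<dots> \<le> norm (complex_of_real x - \<i> * of_real t)" by (rule abs_Im_le_cmod)
  finally show ?thesis using assms by (simp add: norm_divide frac_le)
qed

lemma mult_resolvent:
  assumes M: "eigensystem n M lam u" and t: "t > 0" and "i < n" "k < n"
  shows "(\<Sum>j<n. of_real (M i j) * resolvent n lam u t j k) = of_bool (i = k) + \<i> * of_real t * resolvent n lam u t i k"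
proof -
  define d where "d l = complex_of_real (lam l) - \<i> * of_real t" for l
  have d: "d l \<noteq> 0" for l using shifted_nonzero[of t] t by (simp add: d_def)
  have "(\<Sum>j<n. of_real (M i j) * resolvent n lam u t j k)
      = (\<Sum>j<n. \<Sum>l<n. of_real (M i j * u l j) * of_real (u l k) / d l)"
    unfolding resolvent_def d_def[symmetric] by (simp add: sum_distrib_left mult_ac)
  also have "\<dots> = (\<Sum>l<n. of_real (\<Sum>j<n. M i j * u l j) * of_real (u l k) / d l)"
    by (subst sum.swap) (simp add: sum_distrib_right sum_divide_distrib)
  also have "\<dots> = (\<Sum>l<n. of_real (u l i * u l k) + \<i> * of_real t * (of_real (u l i * u l k) / d l))"
  proof (intro sum.cong refl)
    fix l assume "l \<in> {..<n}"
    then have "(\<Sum>j<n. M i j * u l j) = lam l * u l i" using eigensystem_eigenvector[OF M] assms by simp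
    moreover have "of_real (lam l) = d l + \<i> * of_real t" by (simp add: d_def)
    ultimately show "of_real (\<Sum>j<n. M i j * u l j) * of_real (u l k) / d l =
       of_real (u l i * u l k) + \<i> * of_real t * (of_real (u l i * u l k) / d l)"
      using d[of l] by (simp add: field_simps)
  qed
  also have "\<dots> = of_real (\<Sum>l<n. u l i * u l k) + \<i> * of_real t * resolvent n lam u t i k"
    unfolding resolvent_def d_def[symmetric] by (simp add: sum.distrib sum_distrib_left)
  finally show ?thesis unfolding eigensystem_complete[OF M assms(3,4)] by simp
qed

lemma resolvent_mult:
  assumes "eigensystem n M lam u" "t > 0" "i < n" "k < n"
  shows "(\<Sum>j<n. resolvent n lam u t i j * of_real (M j k)) = of_bool (i = k) + \<i> * of_real t * resolvent n lam u t i k"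
proof -
  have "(\<Sum>j<n. resolvent n lam u t i j * of_real (M j k)) = (\<Sum>j<n. of_real (M k j) * resolvent n lam u t j i)"
    using assms by (intro sum.cong) (auto simp: resolvent_sym[of n lam u t i] eigensystem_sym[OF assms(1), of _ k])
  then show ?thesis using mult_resolvent[OF assms(1,2,4,3)] resolvent_sym[of n lam u t k i] by auto
qed

text \<open>
  Parseval's identity: in the orthonormal basis \<open>u\<close> the row has the coordinates
  \<open>u k i / (lam k - \<i> t)\<close>, whose modulus is at most \<open>\<bar>u k i\<bar> / t\<close>.
\<close>
lemma resolvent_row_norm:
  assumes M: "eigensystem n M lam u" and t: "t > 0" and i: "i < n"
  shows "(\<Sum>j<n. (norm (resolvent n lam u t i j))\<^sup>2) \<le> 1 / t\<^sup>2"
proof -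
  define c where "c k = of_real (u k i) / (complex_of_real (lam k) - \<i> * of_real t)" for k
  have G: "resolvent n lam u t i j = (\<Sum>k<n. c k * of_real (u k j))" for j
    by (simp add: resolvent_def c_def)
  have "complex_of_real (\<Sum>j<n. (norm (resolvent n lam u t i j))\<^sup>2)
      = (\<Sum>j<n. (\<Sum>k<n. c k * of_real (u k j)) * (\<Sum>l<n. cnj (c l) * of_real (u l j)))"
    unfolding of_real_sum complex_norm_square G by simp
  also have "\<dots> = (\<Sum>j<n. \<Sum>k<n. \<Sum>l<n. c k * cnj (c l) * of_real (u k j * u l j))"
    by (simp add: sum_product mult_ac)
  also have "\<dots> = (\<Sum>k<n. \<Sum>l<n. \<Sum>j<n. c k * cnj (c l) * of_real (u k j * u l j))"
    by (subst sum.swap, rule sum.cong[OF refl], rule sum.swap)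
  also have "\<dots> = (\<Sum>k<n. \<Sum>l<n. c k * cnj (c l) * of_real (\<Sum>j<n. u k j * u l j))"
    by (simp add: sum_distrib_left)
  also have "\<dots> = (\<Sum>k<n. \<Sum>l<n. if l = k then c k * cnj (c k) else 0)"
    using M by (intro sum.cong refl) (auto simp: eigensystem_def)
  also have "\<dots> = (\<Sum>k<n. of_real ((norm (c k))\<^sup>2))"
    by (intro sum.cong) (auto simp: complex_norm_square simp del: of_real_power)
  also have "\<dots> = of_real (\<Sum>k<n. (norm (c k))\<^sup>2)" by simp
  finally have "(\<Sum>j<n. (norm (resolvent n lam u t i j))\<^sup>2) = (\<Sum>k<n. (norm (c k))\<^sup>2)"
    using of_real_eq_iff by blast
  also have "\<dots> \<le> (\<Sum>k<n. (u k i)\<^sup>2 * (1 / t)\<^sup>2)"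
  proof (intro sum_mono)
    fix k
    have "norm (c k) = \<bar>u k i\<bar> * norm (1 / (complex_of_real (lam k) - \<i> * of_real t))"
      by (simp add: c_def norm_divide)
    also have "\<dots> \<le> \<bar>u k i\<bar> * (1 / t)"
      by (intro mult_left_mono norm_inverse_shifted_le t) auto
    finally have "(norm (c k))\<^sup>2 \<le> (\<bar>u k i\<bar> * (1 / t))\<^sup>2" by (intro power_mono) auto
    then show "(norm (c k))\<^sup>2 \<le> (u k i)\<^sup>2 * (1 / t)\<^sup>2" by (simp only: power_mult_distrib power2_abs)
  qed
  also have "\<dots> = (\<Sum>k<n. u k i * u k i) * (1 / t)\<^sup>2" by (simp add: sum_divide_distrib power2_eq_square)
  also have "\<dots> = 1 / t\<^sup>2" using M i by (simp add: eigensystem_def power_divide)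
  finally show ?thesis .
qed

lemma resolvent_entry_norm:
  assumes "eigensystem n M lam u" and t: "t > 0" and "i < n" "j < n"
  shows "norm (resolvent n lam u t i j) \<le> 1 / t"
proof -
  have "(norm (resolvent n lam u t i j))\<^sup>2 \<le> (\<Sum>j<n. (norm (resolvent n lam u t i j))\<^sup>2)"
    using assms by (intro member_le_sum) auto
  also have "\<dots> \<le> (1 / t)\<^sup>2" using resolvent_row_norm[OF assms(1-3)] by (simp add: power_divide)
  finally show ?thesis by (rule power2_le_imp_le) (use t in auto)
qed

text \<open>
  The sum is the quadratic form of the resolvent at the all-ones vector, so the operator norm gives
  \<open>n / t\<close>, whereas the row bounds would only give \<open>n * sqrt n / t\<close>. This gain is what
  makes the nonzero mean of the random entries negligible.
\<close>
lemma resolvent_total_norm: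
  assumes M: "eigensystem n M lam u" and t: "t > 0"
  shows "norm (\<Sum>i<n. \<Sum>j<n. resolvent n lam u t i j) \<le> n / t"
proof -
  have "(\<Sum>i<n. \<Sum>j<n. resolvent n lam u t i j)
      = (\<Sum>i<n. \<Sum>k<n. \<Sum>j<n. of_real (u k i * u k j) / (of_real (lam k) - \<i> * of_real t))"
    unfolding resolvent_def by (rule sum.cong[OF refl], rule sum.swap)
  also have "\<dots> = (\<Sum>k<n. \<Sum>i<n. \<Sum>j<n. of_real (u k i * u k j) / (of_real (lam k) - \<i> * of_real t))"
    by (rule sum.swap)
  also have "\<dots> = (\<Sum>k<n. of_real ((\<Sum>i<n. u k i)\<^sup>2) * (1 / (of_real (lam k) - \<i> * of_real t)))"
    by (intro sum.cong refl)
      (simp add: power2_eq_square sum_product sum_divide_distrib)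
  also have "norm \<dots> \<le> (\<Sum>k<n. norm (of_real ((\<Sum>i<n. u k i)\<^sup>2) * (1 / (of_real (lam k) - \<i> * of_real t))))"
    by (rule norm_sum)
  also have "\<dots> \<le> (\<Sum>k<n. (\<Sum>i<n. u k i)\<^sup>2 * (1 / t))"
    unfolding norm_mult by (intro sum_mono mult_mono norm_inverse_shifted_le t) (auto simp del: of_real_sum of_real_power)
  also have "\<dots> = (\<Sum>k<n. \<Sum>i<n. \<Sum>j<n. u k i * u k j) / t"
    by (simp add: power2_eq_square sum_product sum_divide_distrib)
  also have "(\<Sum>k<n. \<Sum>i<n. \<Sum>j<n. u k i * u k j) = (\<Sum>i<n. \<Sum>j<n. \<Sum>k<n. u k i * u k j)"
    by (subst sum.swap, rule sum.cong[OF refl], rule sum.swap)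
  also have "\<dots> = (\<Sum>i<n. \<Sum>j<n. if j = i then 1 else 0)"
    using M by (intro sum.cong refl) (auto simp: eigensystem_def)
  also have "\<dots> = n" by simp
  finally show ?thesis .
qed

lemma resolvent_trace:
  assumes M: "eigensystem n M lam u"
  shows "(\<Sum>i<n. resolvent n lam u t i i) = (\<Sum>k<n. 1 / (of_real (lam k) - \<i> * of_real t))"
proof -
  have "(\<Sum>i<n. resolvent n lam u t i i)
      = (\<Sum>k<n. of_real (\<Sum>i<n. u k i * u k i) / (of_real (lam k) - \<i> * of_real t))"
    unfolding resolvent_def by (subst sum.swap) (simp add: sum_divide_distrib)
  also have "\<dots> = (\<Sum>k<n. 1 / (of_real (lam k) - \<i> * of_real t))"
    by (intro sum.cong refl) (simp add: eigensystem_orthonormal[OF M] del: of_real_sum of_real_mult)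
  finally show ?thesis .
qed

text \<open>
  The product \<open>G0 (M1 - M0) G1\<close> is evaluated twice, by absorbing \<open>M1\<close> into \<open>G1\<close> and \<open>M0\<close> into \<open>G0\<close>;
  the terms with \<open>\<i> t\<close> cancel.
\<close>
lemma resolvent_identity:
  assumes M0: "eigensystem n M0 lam0 u0" and M1: "eigensystem n M1 lam1 u1" and t: "t > 0"
    and "a < n" "b < n"
  shows "resolvent n lam0 u0 t a b - resolvent n lam1 u1 t a b =
    (\<Sum>i<n. \<Sum>j<n. resolvent n lam0 u0 t a i * of_real (M1 i j - M0 i j) * resolvent n lam1 u1 t j b)"
proof -
  let ?G0 = "resolvent n lam0 u0 t" and ?G1 = "resolvent n lam1 u1 t"
  have "(\<Sum>i<n. \<Sum>j<n. ?G0 a i * of_real (M1 i j) * ?G1 j b) = (\<Sum>i<n. ?G0 a i * (\<Sum>j<n. of_real (M1 i j) * ?G1 j b))"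
    by (simp add: sum_distrib_left mult.assoc)
  also have "\<dots> = (\<Sum>i<n. ?G0 a i * (of_bool (i = b) + \<i> * of_real t * ?G1 i b))"
    using assms by (intro sum.cong refl) (simp add: mult_resolvent[OF M1])
  also have "\<dots> = (\<Sum>i<n. (if i = b then ?G0 a i else 0)) + (\<Sum>i<n. ?G0 a i * (\<i> * of_real t * ?G1 i b))"
    unfolding sum.distrib[symmetric] by (intro sum.cong refl) (auto simp: algebra_simps)
  finally have 1: "(\<Sum>i<n. \<Sum>j<n. ?G0 a i * of_real (M1 i j) * ?G1 j b) =
      ?G0 a b + (\<Sum>i<n. ?G0 a i * (\<i> * of_real t * ?G1 i b))" using assms by simp
  have "(\<Sum>i<n. \<Sum>j<n. ?G0 a i * of_real (M0 i j) * ?G1 j b) = (\<Sum>j<n. (\<Sum>i<n. ?G0 a i * of_real (M0 i j)) * ?G1 j b)"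
    by (subst sum.swap) (simp add: sum_distrib_right)
  also have "\<dots> = (\<Sum>j<n. (of_bool (a = j) + \<i> * of_real t * ?G0 a j) * ?G1 j b)"
    using assms by (intro sum.cong refl) (simp add: resolvent_mult[OF M0])
  also have "\<dots> = (\<Sum>j<n. (if j = a then ?G1 j b else 0)) + (\<Sum>j<n. ?G0 a j * (\<i> * of_real t * ?G1 j b))"
    unfolding sum.distrib[symmetric] by (intro sum.cong refl) (auto simp: algebra_simps)
  finally have 2: "(\<Sum>i<n. \<Sum>j<n. ?G0 a i * of_real (M0 i j) * ?G1 j b) =
      ?G1 a b + (\<Sum>j<n. ?G0 a j * (\<i> * of_real t * ?G1 j b))" using assms by simp
  have "(\<Sum>i<n. \<Sum>j<n. ?G0 a i * of_real (M1 i j - M0 i j) * ?G1 j b) =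
     (\<Sum>i<n. \<Sum>j<n. ?G0 a i * of_real (M1 i j) * ?G1 j b) - (\<Sum>i<n. \<Sum>j<n. ?G0 a i * of_real (M0 i j) * ?G1 j b)"
    by (simp add: sum_subtractf[symmetric] algebra_simps)
  then show ?thesis unfolding 1 2 by simp
qed

lemma resolvent_edge_difference:
  assumes M0: "eigensystem n M0 lam0 u0" and M1: "eigensystem n M1 lam1 u1" and t: "t > 0"
    and ij: "i < n" "j < n" "i \<noteq> j"
    and diff: "\<And>a b. a < n \<Longrightarrow> b < n \<Longrightarrow> M1 a b - M0 a b = (if {a,b} = {i,j} then d else 0)"
    and "a < n" "b < n"
  shows "resolvent n lam0 u0 t a b - resolvent n lam1 u1 t a b =
    of_real d * (resolvent n lam0 u0 t a i * resolvent n lam1 u1 t j b + resolvent n lam0 u0 t a j * resolvent n lam1 u1 t i b)"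
proof -
  let ?G0 = "resolvent n lam0 u0 t" and ?G1 = "resolvent n lam1 u1 t"
  have "(\<Sum>x<n. \<Sum>y<n. ?G0 a x * of_real (M1 x y - M0 x y) * ?G1 y b)
      = (\<Sum>x<n. \<Sum>y<n. (if x = i then (if y = j then of_real d * ?G0 a i * ?G1 j b else 0) else 0)
                     + (if x = j then (if y = i then of_real d * ?G0 a j * ?G1 i b else 0) else 0))"
    using ij(3) by (intro sum.cong refl) (auto simp: diff doubleton_eq_iff)
  also have "\<dots> = (\<Sum>x<n. \<Sum>y<n. (if x = i then (if y = j then of_real d * ?G0 a i * ?G1 j b else 0) else 0))
        + (\<Sum>x<n. \<Sum>y<n. (if x = j then (if y = i then of_real d * ?G0 a j * ?G1 i b else 0) else 0))"
    by (simp only: sum.distrib)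
  also have "(\<Sum>x<n. \<Sum>y<n. (if x = i then (if y = j then of_real d * ?G0 a i * ?G1 j b else 0) else 0))
      = (\<Sum>x<n. if x = i then of_real d * ?G0 a i * ?G1 j b else 0)"
    using ij by (intro sum.cong refl) auto
  also have "(\<Sum>x<n. \<Sum>y<n. (if x = j then (if y = i then of_real d * ?G0 a j * ?G1 i b else 0) else 0))
      = (\<Sum>x<n. if x = j then of_real d * ?G0 a j * ?G1 i b else 0)"
    using ij by (intro sum.cong refl) auto
  finally show ?thesis unfolding resolvent_identity[OF M0 M1 t assms(8,9)] using ij
    by (simp add: algebra_simps)
qed

lemma norm_sum_mult_le:
  fixes f g :: "'a \<Rightarrow> complex"
  assumes "c > 0" "(\<Sum>x\<in>A. (norm (f x))\<^sup>2) \<le> c" "(\<Sum>x\<in>A. (norm (g x))\<^sup>2) \<le> c"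
  shows "norm (\<Sum>x\<in>A. f x * g x) \<le> c"
proof -
  have "norm (\<Sum>x\<in>A. f x * g x) \<le> (\<Sum>x\<in>A. norm (f x) * norm (g x))"
    using norm_sum[of "\<lambda>x. f x * g x"] by (simp add: norm_mult)
  also have "\<dots> \<le> (\<Sum>x\<in>A. ((norm (f x))\<^sup>2 + (norm (g x))\<^sup>2) / 2)"
    proof (intro sum_mono)
    fix x
    show "norm (f x) * norm (g x) \<le> ((norm (f x))\<^sup>2 + (norm (g x))\<^sup>2) / 2"
      using sum_squares_bound[of "norm (f x)" "norm (g x)"] by simp
  qed
  also have "\<dots> \<le> c" using assms by (simp add: sum.distrib sum_divide_distrib[symmetric])
  finally show ?thesis .
qed

text \<open>
  The difference of the traces obeys the same bound as that of a single entry: summing over the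
  diagonal first leaves scalar products of rows, to which Cauchy-Schwarz applies. The
  normalised trace therefore changes by a factor \<open>1 / n\<close> less than an entry.
\<close>
lemma resolvent_edge_difference_norm:
  assumes M0: "eigensystem n M0 lam0 u0" and M1: "eigensystem n M1 lam1 u1" and t: "t > 0"
    and ij: "i < n" "j < n" "i \<noteq> j"
    and diff: "\<And>a b. a < n \<Longrightarrow> b < n \<Longrightarrow> M1 a b - M0 a b = (if {a,b} = {i,j} then d else 0)"
  shows "a < n \<Longrightarrow> b < n \<Longrightarrow> norm (resolvent n lam0 u0 t a b - resolvent n lam1 u1 t a b) \<le> 2 * \<bar>d\<bar> / t\<^sup>2" (is "_ \<Longrightarrow> _ \<Longrightarrow> ?thesis1")
    and "norm ((\<Sum>a<n. resolvent n lam0 u0 t a a) - (\<Sum>a<n. resolvent n lam1 u1 t a a)) \<le> 2 * \<bar>d\<bar> / t\<^sup>2" (is ?thesis2)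
proof -
  let ?G0 = "resolvent n lam0 u0 t" and ?G1 = "resolvent n lam1 u1 t"
  note D = resolvent_edge_difference[OF M0 M1 t ij diff]
  show ?thesis1 if "a < n" "b < n"
  proof -
    have "norm (?G0 a i * ?G1 j b) \<le> (1/t) * (1/t)" "norm (?G0 a j * ?G1 i b) \<le> (1/t) * (1/t)"
      unfolding norm_mult using that ij t M0 M1 by (intro mult_mono resolvent_entry_norm; auto)+
    then have "norm (?G0 a i * ?G1 j b + ?G0 a j * ?G1 i b) \<le> 2 / t\<^sup>2"
      by (intro norm_triangle_le) (simp add: power2_eq_square)
    then have "\<bar>d\<bar> * norm (?G0 a i * ?G1 j b + ?G0 a j * ?G1 i b) \<le> \<bar>d\<bar> * (2 / t\<^sup>2)"
      by (rule mult_left_mono) auto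
    then show ?thesis unfolding D[OF _ _ that, simplified] by (simp add: norm_mult mult_ac)
  qed
  have "(\<Sum>a<n. ?G0 a a) - (\<Sum>a<n. ?G1 a a) = of_real d * ((\<Sum>a<n. ?G0 i a * ?G1 j a) + (\<Sum>a<n. ?G0 j a * ?G1 i a))"
    unfolding sum_subtractf[symmetric] sum.distrib[symmetric] sum_distrib_left
    by (intro sum.cong refl) (simp add: D resolvent_sym[of n lam0 u0 t i] resolvent_sym[of n lam0 u0 t j])
  moreover have "norm (\<Sum>a<n. ?G0 i a * ?G1 j a) \<le> 1 / t\<^sup>2" "norm (\<Sum>a<n. ?G0 j a * ?G1 i a) \<le> 1 / t\<^sup>2"
    using t ij M0 M1 by (intro norm_sum_mult_le resolvent_row_norm; auto)+
  then have "norm ((\<Sum>a<n. ?G0 i a * ?G1 j a) + (\<Sum>a<n. ?G0 j a * ?G1 i a)) \<le> 2 / t\<^sup>2"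
    by (intro norm_triangle_le) simp
  then have "\<bar>d\<bar> * norm ((\<Sum>a<n. ?G0 i a * ?G1 j a) + (\<Sum>a<n. ?G0 j a * ?G1 i a)) \<le> \<bar>d\<bar> * (2 / t\<^sup>2)"
    by (rule mult_left_mono) auto
  ultimately show ?thesis2 by (simp add: norm_mult mult_ac)
qed

section \<open>Redrawing a single edge\<close>
abbreviation ER_expectation :: "nat \<Rightarrow> real \<Rightarrow> (nat set set \<Rightarrow> 'a) \<Rightarrow> 'a::{banach, second_countable_topology}" where
  "ER_expectation n p \<equiv> measure_pmf.expectation (erdos_renyi n p)"

lemma finite_all_edges: "finite (all_edges n)"
  by (rule finite_subset[of _ "Pow {..<n}"]) (auto simp: all_edges_def)

lemma pair_in_all_edges: "{i, j} \<in> all_edges n \<longleftrightarrow> i < n \<and> j < n \<and> i \<noteq> j"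
  by (auto simp: all_edges_def card_insert_if)

lemma set_erdos_renyi: "set_pmf (erdos_renyi n p) \<subseteq> Pow (all_edges n)"
  by (auto simp: erdos_renyi_def)

lemma finite_set_erdos_renyi: "finite (set_pmf (erdos_renyi n p))"
  using set_erdos_renyi finite_all_edges by (rule finite_subset[OF _ finite_Pow_iff[THEN iffD2]])

lemma integrable_erdos_renyi [simp]:
  fixes f :: "nat set set \<Rightarrow> 'a::{banach, second_countable_topology}"
  shows "integrable (measure_pmf (erdos_renyi n p)) f"
  by (rule integrable_measure_pmf_finite[OF finite_set_erdos_renyi])

text \<open>
  The presence of \<open>e\<close> is independent of all other edges, so redrawing it with
  probability \<open>p\<close> does not change the distribution.
\<close>
lemma erdos_renyi_resample_edge:
  fixes \<Phi> :: "nat set set \<Rightarrow> 'a::{banach, second_countable_topology}"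
  assumes p: "0 \<le> p" "p \<le> 1" and e: "e \<in> all_edges n"
  shows "ER_expectation n p \<Phi> =
    ER_expectation n p (\<lambda>E. p *\<^sub>R \<Phi> (insert e E) + (1 - p) *\<^sub>R \<Phi> (E - {e}))"
proof -
  define A where "A = all_edges n - {e}"
  have A: "finite A" "e \<notin> A" "all_edges n = insert e A" using finite_all_edges e by (auto simp: A_def)
  \<comment> \<open>The random graph on the edges other than \<open>e\<close>; what remains is one coin toss for \<open>e\<close>.\<close>
  define Q where "Q = map_pmf (\<lambda>f. {x \<in> A. f x}) (Pi_pmf A False (\<lambda>_. bernoulli_pmf p))"
  have Q: "set_pmf Q \<subseteq> Pow A" by (auto simp: Q_def)
  have finQ: "finite (set_pmf Q)" using Q A(1) by (rule finite_subset[OF _ finite_Pow_iff[THEN iffD2]])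
  have ER: "erdos_renyi n p = bernoulli_pmf p \<bind> (\<lambda>y. map_pmf (\<lambda>E. if y then insert e E else E) Q)"
  proof -
    have "erdos_renyi n p = map_pmf (\<lambda>f. {x \<in> insert e A. f x})
        (bernoulli_pmf p \<bind> (\<lambda>y. map_pmf (\<lambda>f. f(e := y)) (Pi_pmf A False (\<lambda>_. bernoulli_pmf p))))"
      unfolding erdos_renyi_def A(3) Pi_pmf_insert'[OF A(1,2)] map_pmf_def by simp
    also have "\<dots> = bernoulli_pmf p \<bind> (\<lambda>y. map_pmf (\<lambda>f. {x \<in> insert e A. (f(e := y)) x}) (Pi_pmf A False (\<lambda>_. bernoulli_pmf p)))"
      by (simp add: map_bind_pmf pmf.map_comp o_def)
    also have "\<dots> = bernoulli_pmf p \<bind> (\<lambda>y. map_pmf (\<lambda>E. if y then insert e E else E) Q)"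
      unfolding Q_def pmf.map_comp o_def using A(2)
      by (intro bind_pmf_cong map_pmf_cong refl) auto
    finally show ?thesis .
  qed
  have split: "ER_expectation n p \<Psi> = p *\<^sub>R measure_pmf.expectation Q (\<lambda>E. \<Psi> (insert e E)) + (1 - p) *\<^sub>R measure_pmf.expectation Q \<Psi>"
    for \<Psi> :: "nat set set \<Rightarrow> 'a"
    unfolding ER by (subst pmf_expectation_bind[of UNIV]) (use finQ p in \<open>auto simp: UNIV_bool\<close>)
  have "measure_pmf.expectation Q (\<lambda>E. \<Phi> (E - {e})) = measure_pmf.expectation Q \<Phi>"
    using Q A(2) by (intro integral_cong_AE) (auto simp: AE_measure_pmf_iff intro!: arg_cong[of _ _ \<Phi>])
  moreover have "measure_pmf.expectation Q (\<lambda>E. \<Phi> (insert e E - {e})) = measure_pmf.expectation Q \<Phi>"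
    using Q A(2) by (intro integral_cong_AE) (auto simp: AE_measure_pmf_iff intro!: arg_cong[of _ _ \<Phi>])
  moreover have "ER_expectation n p (\<lambda>E. \<Phi> (insert e E)) = measure_pmf.expectation Q (\<lambda>E. \<Phi> (insert e E))"
    unfolding split by (simp add: scaleR_add_left[symmetric])
  moreover have "ER_expectation n p (\<lambda>E. \<Phi> (E - {e})) = measure_pmf.expectation Q \<Phi>"
    unfolding split using calculation(1,2) by (simp add: scaleR_add_left[symmetric])
  ultimately show ?thesis using split[of \<Phi>] by simp
qed

text \<open>
  For the distances \<open>D = 1\<close> and \<open>D = 2\<close> the quantity \<open>(D + D\<^sup>2) / 2\<close> takes these two values.
\<close>
definition edge_weight :: "nat set set \<Rightarrow> nat set \<Rightarrow> real" where
  "edge_weight E e = (if e \<in> E then 1 else 3)"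

text \<open>
  A discrete form of Gaussian integration by parts. The weight has mean \<open>3 - 2 p\<close>; the centred weight
  is \<open>- 2 (1 - p)\<close> with probability \<open>p\<close> and \<open>2 p\<close> with probability \<open>1 - p\<close>, so that both cases
  contribute with the factor \<open>2 p (1 - p)\<close> and opposite signs.
\<close>
lemma edge_integration_by_parts:
  fixes H :: "nat set set \<Rightarrow> complex"
  assumes p: "0 \<le> p" "p \<le> 1" and e: "e \<in> all_edges n"
  shows "ER_expectation n p (\<lambda>E. of_real (edge_weight E e - (3 - 2 * p)) * H E) =
    ER_expectation n p (\<lambda>E. of_real (2 * p * (1 - p)) * (H (E - {e}) - H (insert e E)))"
  by (subst erdos_renyi_resample_edge[OF assms])
    (intro arg_cong[of _ _ "ER_expectation n p"] ext,
      simp add: edge_weight_def scaleR_conv_of_real algebra_simps)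

definition scaled_mat :: "nat \<Rightarrow> nat set set \<Rightarrow> nat \<Rightarrow> nat \<Rightarrow> real" where
  "scaled_mat n E i j = (if i = j then 0 else edge_weight E {i, j} / sqrt (real n))"

section \<open>The self-consistent equation for the Stieltjes transform\<close>

text \<open>
  Eigenvectors are not unique, so an arbitrary choice of an eigensystem for each graph is a parameter;
  the resolvent, and with it every estimate on it, depends on the matrix alone.
\<close>
locale scaled_resolvent =
  fixes n :: nat and p t :: real and lam :: "nat set set \<Rightarrow> nat \<Rightarrow> real" and u :: "nat set set \<Rightarrow> nat \<Rightarrow> nat \<Rightarrow> real"
  assumes n: "n \<ge> 1" and p: "0 \<le> p" "p \<le> 1" and t: "t > 0"
    and eig: "\<And>E. eigensystem n (scaled_mat n E) (lam E) (u E)"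
begin

text \<open>
  Four times the variance of the presence of an edge, which is the variance of its weight.
\<close>
abbreviation "\<tau>2 \<equiv> 4 * p * (1 - p)"

definition G :: "nat set set \<Rightarrow> nat \<Rightarrow> nat \<Rightarrow> complex" where
  "G E = resolvent n (lam E) (u E) t"

text \<open>
  The Stieltjes transform of the empirical eigenvalue distribution at \<open>\<i> t\<close>.
\<close>
definition stieltjes :: "nat set set \<Rightarrow> complex" where
  "stieltjes E = (\<Sum>i<n. G E i i) / of_nat n"

text \<open>
  The Stieltjes transform of the semicircle law of variance \<open>\<tau>2\<close> is a zero of this quadratic
  expression.
\<close>
definition defect :: "nat set set \<Rightarrow> complex" where
  "defect E = 1 + \<i> * of_real t * stieltjes E + of_real \<tau>2 * (stieltjes E)\<^sup>2"

lemma tau2: "\<tau>2 \<ge> 0" using p by simp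

lemma sqrt_n: "sqrt n \<ge> 1" using n by simp

lemma G_sym: "G E i j = G E j i" unfolding G_def by (rule resolvent_sym)

lemma G_norm: "i < n \<Longrightarrow> j < n \<Longrightarrow> norm (G E i j) \<le> 1 / t"
  unfolding G_def by (rule resolvent_entry_norm[OF eig t])

lemma G_mult_norm:
  assumes "i < n" "j < n" "k < n" "l < n"
  shows "norm (G E i j * G E' k l) \<le> 1 / t\<^sup>2"
proof -
  have "norm (G E i j * G E' k l) \<le> (1/t) * (1/t)" unfolding norm_mult
    using t assms by (intro mult_mono G_norm) auto
  then show ?thesis by (simp add: power2_eq_square)
qed

lemma scaled_mat_flip:
  assumes "i \<noteq> j"
  shows "scaled_mat n (insert {i,j} E) a b - scaled_mat n (E - {{i,j}}) a b = (if {a,b} = {i,j} then - 2 / sqrt n else 0)"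
  using assms by (auto simp: scaled_mat_def edge_weight_def diff_divide_distrib[symmetric])

lemma
  fixes E
  assumes ij: "i < n" "j < n" "i \<noteq> j"
  defines "E0 \<equiv> E - {{i,j}}" and "E1 \<equiv> insert {i,j} E"
  shows G_flip: "a < n \<Longrightarrow> b < n \<Longrightarrow> G E0 a b - G E1 a b =
      of_real (- 2 / sqrt n) * (G E0 a i * G E1 j b + G E0 a j * G E1 i b)"
    and G_flip_norm: "a < n \<Longrightarrow> b < n \<Longrightarrow> norm (G E0 a b - G E1 a b) \<le> 4 / (sqrt n * t\<^sup>2)"
    and stieltjes_flip_norm: "norm (stieltjes E0 - stieltjes E1) \<le> 4 / t\<^sup>2 / n"
proof -
  note M = eig[of E0] eig[of E1] t ij
  have d: "scaled_mat n E1 a b - scaled_mat n E0 a b = (if {a,b} = {i,j} then - 2 / sqrt n else 0)" for a b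
    unfolding E0_def E1_def by (rule scaled_mat_flip[OF ij(3)])
  show "a < n \<Longrightarrow> b < n \<Longrightarrow> G E0 a b - G E1 a b =
      of_real (- 2 / sqrt n) * (G E0 a i * G E1 j b + G E0 a j * G E1 i b)"
    unfolding G_def by (rule resolvent_edge_difference[OF M d])
  have "2 * \<bar>- 2 / sqrt n\<bar> / t\<^sup>2 = 4 / (sqrt n * t\<^sup>2)" by simp
  with resolvent_edge_difference_norm(1)[OF M d]
  show "a < n \<Longrightarrow> b < n \<Longrightarrow> norm (G E0 a b - G E1 a b) \<le> 4 / (sqrt n * t\<^sup>2)" unfolding G_def by metis
  have "stieltjes E0 - stieltjes E1 = ((\<Sum>a<n. G E0 a a) - (\<Sum>a<n. G E1 a a)) / of_nat n"
    by (simp add: stieltjes_def diff_divide_distrib)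
  then have "norm (stieltjes E0 - stieltjes E1) = norm ((\<Sum>a<n. G E0 a a) - (\<Sum>a<n. G E1 a a)) / n"
    by (simp add: norm_divide)
  also have "\<dots> \<le> (2 * \<bar>- 2 / sqrt n\<bar> / t\<^sup>2) / n"
    unfolding G_def by (intro divide_right_mono resolvent_edge_difference_norm(2)[OF M d]) auto
  also have "\<dots> \<le> (4 / t\<^sup>2) / n"
    using sqrt_n by (intro divide_right_mono) (auto simp: field_simps)
  finally show "norm (stieltjes E0 - stieltjes E1) \<le> 4 / t\<^sup>2 / n" .
qed

lemma stieltjes_norm: "norm (stieltjes E) \<le> 1 / t"
proof -
  have "norm (\<Sum>i<n. G E i i) \<le> (\<Sum>i<n. 1 / t)" by (intro sum_norm_le G_norm) auto
  then have "norm (\<Sum>i<n. G E i i) / n \<le> (n * (1 / t)) / n" by (intro divide_right_mono) auto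
  then show ?thesis using n by (simp add: stieltjes_def norm_divide)
qed

lemma defect_norm: "norm (defect E) \<le> 2 + \<tau>2 / t\<^sup>2"
proof -
  have "norm (\<i> * of_real t * stieltjes E) \<le> 1"
    using mult_left_mono[OF stieltjes_norm[of E], of t] t by (simp add: norm_mult)
  moreover have "norm (of_real \<tau>2 * (stieltjes E)\<^sup>2) \<le> \<tau>2 / t\<^sup>2"
  proof -
    have "(norm (stieltjes E))\<^sup>2 \<le> (1 / t)\<^sup>2" by (intro power_mono stieltjes_norm) auto
    then have "\<tau>2 * (norm (stieltjes E))\<^sup>2 \<le> \<tau>2 * (1 / t)\<^sup>2" by (intro mult_left_mono tau2)
    moreover have "norm (of_real \<tau>2 :: complex) = \<tau>2" using tau2 by (simp only: norm_of_real abs_of_nonneg)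
    ultimately show ?thesis unfolding norm_mult norm_power by (simp add: power_divide)
  qed
  ultimately show ?thesis unfolding defect_def
    by (smt (verit) norm_triangle_ineq norm_one)
qed

lemma defect_flip_norm:
  assumes ij: "i < n" "j < n" "i \<noteq> j"
  shows "norm (defect (E - {{i,j}}) - defect (insert {i,j} E)) \<le> (4 / t\<^sup>2 * (t + 2 * \<tau>2 / t)) / n"
proof -
  let ?a = "stieltjes (E - {{i,j}})" and ?b = "stieltjes (insert {i,j} E)"
  have eq: "defect (E - {{i,j}}) - defect (insert {i,j} E) = (?a - ?b) * (\<i> * of_real t + of_real \<tau>2 * (?a + ?b))"
    unfolding defect_def by (simp add: algebra_simps power2_eq_square)
  have "norm (\<i> * of_real t + of_real \<tau>2 * (?a + ?b)) \<le> t + 2 * \<tau>2 / t"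
  proof -
    have "norm (?a + ?b) \<le> 1 / t + 1 / t" by (intro norm_triangle_mono stieltjes_norm)
    then have "\<tau>2 * norm (?a + ?b) \<le> \<tau>2 * (1 / t + 1 / t)" by (intro mult_left_mono tau2)
    moreover have "norm (of_real \<tau>2 :: complex) = \<tau>2" using tau2 by (simp only: norm_of_real abs_of_nonneg)
    ultimately have "norm (of_real \<tau>2 * (?a + ?b)) \<le> 2 * \<tau>2 / t" unfolding norm_mult by simp
    moreover have "norm (\<i> * of_real t) = t" using t by (simp add: norm_mult)
    ultimately show ?thesis by (smt (verit) norm_triangle_ineq)
  qed
  then have "norm (defect (E - {{i,j}}) - defect (insert {i,j} E)) \<le> (4 / t\<^sup>2 / n) * (t + 2 * \<tau>2 / t)"
    unfolding eq norm_mult using t tau2 stieltjes_flip_norm[OF ij, of E] by (intro mult_mono) auto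
  then show ?thesis by simp
qed

text \<open>
  By the resolvent identity \<open>G0 j i - G1 j i\<close> is \<open>- 2 / sqrt n\<close> times a product of entries of both
  resolvents, which to leading order is \<open>G i i * G j j + (G j i)\<^sup>2\<close>. Since \<open>E\<close> is one of the two graphs
  \<open>E0\<close> and \<open>E1\<close>, exchanging their resolvents costs a further factor \<open>1 / sqrt n\<close>, and exchanging the
  values of \<open>F\<close> costs \<open>L / n\<close>, so the total error is of order \<open>1 / n\<close>.
\<close>
lemma pair_pointwise:
  fixes F :: "nat set set \<Rightarrow> complex"
  assumes ij: "i < n" "j < n" "i \<noteq> j"
    and K: "\<And>E. norm (F E) \<le> K"
    and L: "norm (F (E - {{i,j}}) - F (insert {i,j} E)) \<le> L / n"
  defines "E0 \<equiv> E - {{i,j}}" and "E1 \<equiv> insert {i,j} E"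
  shows "norm (of_real (2 * p * (1 - p)) * (G E0 j i * F E0 - G E1 j i * F E1)
      + of_real (\<tau>2 / sqrt n) * ((G E i i * G E j j + (G E j i)\<^sup>2) * F E))
    \<le> \<tau>2 * (2 * L / t\<^sup>2 + 8 * K / t ^ 3 + L / t) / n"
proof -
  define X where "X E = G E i i * G E j j + (G E j i)\<^sup>2" for E
  define Y where "Y = G E0 j i * G E1 j i + G E0 j j * G E1 i i"
  have K0: "K \<ge> 0" using K[of "{}"] norm_ge_zero order_trans by blast
  have L0: "L \<ge> 0" using order_trans[OF norm_ge_zero L] n by (simp add: zero_le_divide_iff)
  have EE: "E = E0 \<or> E = E1" unfolding E0_def E1_def by auto
  have gd: "norm (G E0 a b - G E1 a b) \<le> 4 / (sqrt n * t\<^sup>2)" if "a < n" "b < n" for a b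
    unfolding E0_def E1_def by (rule G_flip_norm[OF ij that])
  have prod: "norm (G E' a b * (G E0 c d - G E1 c d)) \<le> 4 / (sqrt n * t ^ 3)" if "a < n" "b < n" "c < n" "d < n" for E' a b c d
  proof -
    have "norm (G E' a b * (G E0 c d - G E1 c d)) \<le> (1 / t) * (4 / (sqrt n * t\<^sup>2))"
      unfolding norm_mult using that t by (intro mult_mono G_norm gd) auto
    then show ?thesis by (simp add: power3_eq_cube power2_eq_square mult_ac)
  qed
  \<comment> \<open>One of the two factors in each product already belongs to the graph \<open>E\<close>.\<close>
  have XY: "norm (X E - Y) \<le> 8 / (sqrt n * t ^ 3)"
  proof -
    have "X E - Y = G E0 j i * (G E0 j i - G E1 j i) + G E0 j j * (G E0 i i - G E1 i i) \<or>
       X E - Y = - (G E1 j i * (G E0 j i - G E1 j i)) - (G E1 i i * (G E0 j j - G E1 j j))"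
      using EE unfolding X_def Y_def by (auto simp: algebra_simps power2_eq_square)
    moreover have "norm (a + b) \<le> 8 / (sqrt n * t ^ 3)" "norm (- a - b) \<le> 8 / (sqrt n * t ^ 3)"
      if "norm a \<le> 4 / (sqrt n * t ^ 3)" "norm b \<le> 4 / (sqrt n * t ^ 3)" for a b :: complex
      using that norm_triangle_ineq[of a b] norm_minus_cancel[of "a + b"] by (auto simp: add.commute)
    ultimately show ?thesis using prod ij by metis
  qed
  have X: "norm (X E) \<le> 2 / t\<^sup>2"
  proof -
    have "norm (X E) \<le> 1 / t\<^sup>2 + 1 / t\<^sup>2" unfolding X_def power2_eq_square[of "G E j i"]
      using ij by (intro norm_triangle_mono G_mult_norm)
    then show ?thesis by simp
  qed
  have FF: "norm (F E - F E0) \<le> L / n"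
    using EE L L0 unfolding E0_def[symmetric] E1_def[symmetric] by (auto simp: norm_minus_commute)
  have br: "norm (X E * F E - Y * F E0) \<le> (2 * L / t\<^sup>2 + 8 * K / t ^ 3) / sqrt n"
  proof -
    have "X E * F E - Y * F E0 = X E * (F E - F E0) + (X E - Y) * F E0" by (simp add: algebra_simps)
    also have "norm \<dots> \<le> (2 / t\<^sup>2) * (L / n) + (8 / (sqrt n * t ^ 3)) * K"
      using X FF XY K[of E0] t by (intro norm_triangle_mono; simp only: norm_mult; intro mult_mono) auto
    also have "\<dots> \<le> (2 / t\<^sup>2) * (L / sqrt n) + (8 / (sqrt n * t ^ 3)) * K"
    proof -
      have "sqrt n * 1 \<le> sqrt n * sqrt n" using sqrt_n by (intro mult_left_mono) auto
      then have "L / n \<le> L / sqrt n" using L0 n by (intro divide_left_mono) auto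
      then show ?thesis by (intro add_right_mono mult_left_mono) auto
    qed
    finally show ?thesis using t by (simp add: add_divide_distrib mult_ac)
  qed
  have GF: "norm (G E1 j i * (F E0 - F E1)) \<le> (1 / t) * (L / n)"
    unfolding norm_mult using t ij L unfolding E0_def[symmetric] E1_def[symmetric]
    by (intro mult_mono G_norm) auto
  have d: "G E0 j i - G E1 j i = of_real (- 2 / sqrt n) * Y"
    unfolding Y_def E0_def E1_def by (rule G_flip[OF ij ij(2,1)])
  have "G E0 j i * F E0 - G E1 j i * F E1 = of_real (- 2 / sqrt n) * Y * F E0 + G E1 j i * (F E0 - F E1)"
    unfolding d[symmetric] by (simp add: algebra_simps)
  then have "of_real (2 * p * (1 - p)) * (G E0 j i * F E0 - G E1 j i * F E1) + of_real (\<tau>2 / sqrt n) * (X E * F E)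
     = of_real (\<tau>2 / sqrt n) * (X E * F E - Y * F E0) + of_real (\<tau>2 / 2) * (G E1 j i * (F E0 - F E1))"
  proof -
    define a r where "a = complex_of_real \<tau>2" and "r = complex_of_real (sqrt n)"
    have "of_real (2 * p * (1 - p)) = a / 2" "of_real (\<tau>2 / sqrt n) = a / r"
      "complex_of_real (- 2 / sqrt n) = - 2 / r" "of_real (\<tau>2 / 2) = a / 2" by (simp_all add: a_def r_def)
    note c = this
    show ?thesis if "G E0 j i * F E0 - G E1 j i * F E1 = of_real (- 2 / sqrt n) * Y * F E0 + G E1 j i * (F E0 - F E1)"
      unfolding that c by (simp add: algebra_simps diff_divide_distrib add_divide_distrib)
  qed
  also have "norm \<dots> \<le> (\<tau>2 / sqrt n) * ((2 * L / t\<^sup>2 + 8 * K / t ^ 3) / sqrt n) + (\<tau>2 / 2) * ((1 / t) * (L / n))"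
  proof (intro norm_triangle_mono)
    show "norm (of_real (\<tau>2 / sqrt n) * (X E * F E - Y * F E0)) \<le> (\<tau>2 / sqrt n) * ((2 * L / t\<^sup>2 + 8 * K / t ^ 3) / sqrt n)"
      unfolding norm_mult norm_of_real using tau2 br by (intro mult_mono) (auto simp del: mult_nonneg_nonneg)
    show "norm (of_real (\<tau>2 / 2) * (G E1 j i * (F E0 - F E1))) \<le> (\<tau>2 / 2) * ((1 / t) * (L / n))"
      unfolding norm_mult[of "of_real _"] norm_of_real using tau2 GF by (intro mult_mono) auto
  qed
  also have "\<dots> = \<tau>2 * (2 * L / t\<^sup>2 + 8 * K / t ^ 3) / (sqrt n * sqrt n) + \<tau>2 * (L / t / 2) / n"
    by (simp only: times_divide_eq_left times_divide_eq_right divide_divide_eq_left mult_1 mult_ac)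
  also have "\<dots> = (\<tau>2 * (2 * L / t\<^sup>2 + 8 * K / t ^ 3) + \<tau>2 * (L / t / 2)) / n"
    by (simp add: add_divide_distrib)
  also have "\<dots> \<le> (\<tau>2 * (2 * L / t\<^sup>2 + 8 * K / t ^ 3) + \<tau>2 * (L / t)) / n"
    proof -
    have half: "x / 2 \<le> x" if "0 \<le> x" for x :: real using that by simp
    have "L / t / 2 \<le> L / t" by (rule half) (use L0 t in simp)
    then show ?thesis by (intro divide_right_mono add_left_mono mult_left_mono tau2) auto
  qed
  also have "\<dots> = \<tau>2 * (2 * L / t\<^sup>2 + 8 * K / t ^ 3 + L / t) / n"
    by (simp only: distrib_left)
  finally show ?thesis unfolding X_def .
qed

lemma pair_expectation:
  fixes F :: "nat set set \<Rightarrow> complex"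
  assumes ij: "i < n" "j < n" "i \<noteq> j"
    and K: "\<And>E. norm (F E) \<le> K"
    and L: "\<And>E. norm (F (E - {{i,j}}) - F (insert {i,j} E)) \<le> L / n"
  shows "norm (ER_expectation n p (\<lambda>E. of_real (edge_weight E {i,j} - (3 - 2 * p)) * (G E j i * F E)
      + of_real (\<tau>2 / sqrt n) * ((G E i i * G E j j + (G E j i)\<^sup>2) * F E)))
    \<le> \<tau>2 * (2 * L / t\<^sup>2 + 8 * K / t ^ 3 + L / t) / n" (is "norm ?lhs \<le> ?C")
proof -
  have e: "{i,j} \<in> all_edges n" using ij by (simp add: pair_in_all_edges)
  define A where "A = (\<lambda>E. of_real (edge_weight E {i,j} - (3 - 2 * p)) * (G E j i * F E))"
  define D where "D = (\<lambda>E. of_real (2 * p * (1 - p)) * (G (E - {{i,j}}) j i * F (E - {{i,j}}) - G (insert {i,j} E) j i * F (insert {i,j} E)))"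
  define R where "R = (\<lambda>E. of_real (\<tau>2 / sqrt n) * ((G E i i * G E j j + (G E j i)\<^sup>2) * F E))"
  have "ER_expectation n p A = ER_expectation n p D"
    unfolding A_def D_def by (rule edge_integration_by_parts[OF p e])
  then have eq: "ER_expectation n p (\<lambda>E. A E + R E) = ER_expectation n p (\<lambda>E. D E + R E)"
    by simp
  have "norm (ER_expectation n p (\<lambda>E. D E + R E)) \<le> ER_expectation n p (\<lambda>E. norm (D E + R E))"
    by (rule integral_norm_bound)
  also have "\<dots> \<le> ER_expectation n p (\<lambda>E. ?C)"
    unfolding D_def R_def by (intro integral_mono integrable_erdos_renyi pair_pointwise ij K L)
  finally have "norm (ER_expectation n p (\<lambda>E. A E + R E)) \<le> ?C" unfolding eq by simp
  then show ?thesis unfolding A_def R_def .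
qed

definition pairs :: "(nat \<times> nat) set" where
  "pairs = {(i,j). i < n \<and> j < n \<and> i \<noteq> j}"

lemma finite_pairs: "finite pairs"
  by (rule finite_subset[of _ "{..<n} \<times> {..<n}"]) (auto simp: pairs_def)

lemma card_pairs: "card pairs \<le> n\<^sup>2"
  using card_mono[of "{..<n} \<times> {..<n}" pairs] by (auto simp: pairs_def power2_eq_square)

lemma sum_pairs:
  fixes f :: "nat \<Rightarrow> nat \<Rightarrow> 'a::ab_group_add"
  shows "(\<Sum>i<n. \<Sum>j<n. f i j) = (\<Sum>(i,j)\<in>pairs. f i j) + (\<Sum>i<n. f i i)"
proof -
  have eq: "{..<n} \<times> {..<n} = pairs \<union> (\<lambda>i. (i,i)) ` {..<n}" by (auto simp: pairs_def)
  have "(\<Sum>i<n. \<Sum>j<n. f i j) = (\<Sum>(i,j)\<in>pairs \<union> (\<lambda>i. (i,i)) ` {..<n}. f i j)"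
    unfolding sum.cartesian_product eq ..
  also have "\<dots> = (\<Sum>(i,j)\<in>pairs. f i j) + (\<Sum>(i,j)\<in>(\<lambda>i. (i,i)) ` {..<n}. f i j)"
    by (rule sum.union_disjoint) (auto simp: finite_pairs, auto simp: pairs_def)
  also have "(\<Sum>(i,j)\<in>(\<lambda>i. (i,i)) ` {..<n}. f i j) = (\<Sum>i<n. f i i)"
    by (subst sum.reindex) (auto simp: inj_on_def)
  finally show ?thesis .
qed

text \<open>
  This is the trace of \<open>M G = 1 + \<i> t G\<close>, divided by \<open>n\<close>; the diagonal of \<open>M\<close> vanishes.
\<close>
lemma stieltjes_equation:
  "1 + \<i> * of_real t * stieltjes E = (\<Sum>(i,j)\<in>pairs. of_real (edge_weight E {i,j}) * G E j i) / of_real (n * sqrt n)"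
proof -
  have "(\<Sum>i<n. 1 + \<i> * of_real t * G E i i) = (\<Sum>i<n. \<Sum>j<n. of_real (scaled_mat n E i j) * G E j i)"
    unfolding G_def by (intro sum.cong refl) (simp add: mult_resolvent[OF eig t])
  also have "\<dots> = (\<Sum>(i,j)\<in>pairs. of_real (scaled_mat n E i j) * G E j i)"
    unfolding sum_pairs by (simp add: scaled_mat_def)
  also have "\<dots> = (\<Sum>(i,j)\<in>pairs. of_real (edge_weight E {i,j}) * G E j i) / of_real (sqrt n)"
    unfolding sum_divide_distrib by (intro sum.cong refl) (auto simp: pairs_def scaled_mat_def)
  finally have "(of_nat n + \<i> * of_real t * (\<Sum>i<n. G E i i)) / of_nat n =
     (\<Sum>(i,j)\<in>pairs. of_real (edge_weight E {i,j}) * G E j i) / of_real (sqrt n) / of_nat n"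
    by (simp add: sum.distrib sum_distrib_left)
  then show ?thesis using n by (simp add: stieltjes_def add_divide_distrib mult_ac)
qed

text \<open>
  The first line is the part that integration by parts makes small, the second collects the mean of
  the weights, and the third corrects for the diagonal terms of \<open>(stieltjes E)\<^sup>2\<close> and for the squares
  \<open>(G E j i)\<^sup>2\<close>.
\<close>
lemma defect_expansion:
  "defect E = (\<Sum>(i,j)\<in>pairs. of_real (edge_weight E {i,j} - (3 - 2 * p)) * G E j i
                 + of_real (\<tau>2 / sqrt n) * (G E i i * G E j j + (G E j i)\<^sup>2)) / of_real (n * sqrt n)
     + of_real (3 - 2 * p) * (\<Sum>(i,j)\<in>pairs. G E j i) / of_real (n * sqrt n)
     + of_real \<tau>2 * ((\<Sum>i<n. (G E i i)\<^sup>2) - (\<Sum>(i,j)\<in>pairs. (G E j i)\<^sup>2)) / (of_nat n)\<^sup>2"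
proof -
  have "(\<Sum>i<n. G E i i)\<^sup>2 = (\<Sum>(i,j)\<in>pairs. G E i i * G E j j) + (\<Sum>i<n. (G E i i)\<^sup>2)"
    unfolding power2_eq_square sum_product sum_pairs ..
  then have s2: "(stieltjes E)\<^sup>2 = ((\<Sum>(i,j)\<in>pairs. G E i i * G E j j) + (\<Sum>i<n. (G E i i)\<^sup>2)) / (of_nat n)\<^sup>2"
    by (simp add: stieltjes_def power_divide)
  have sq: "complex_of_real (\<tau>2 / sqrt n) / of_real (n * sqrt n) = of_real \<tau>2 / (of_nat n)\<^sup>2"
  proof -
    have "(\<tau>2 / sqrt n) / (n * sqrt n) = \<tau>2 / n\<^sup>2"
      by (simp add: power2_eq_square)
    then have "complex_of_real ((\<tau>2 / sqrt n) / (n * sqrt n)) = of_real (\<tau>2 / n\<^sup>2)" by (rule arg_cong)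
    then show ?thesis unfolding of_real_divide[of _ "n * sqrt n"] of_real_divide[of _ "real (n\<^sup>2)"] by (simp only: of_nat_power of_real_power of_real_of_nat_eq)
  qed
  have 1: "(\<Sum>(i,j)\<in>pairs. of_real (edge_weight E {i,j} - (3 - 2 * p)) * G E j i
                 + of_real (\<tau>2 / sqrt n) * (G E i i * G E j j + (G E j i)\<^sup>2)) =
      (\<Sum>(i,j)\<in>pairs. of_real (edge_weight E {i,j}) * G E j i) - of_real (3 - 2 * p) * (\<Sum>(i,j)\<in>pairs. G E j i)
      + of_real (\<tau>2 / sqrt n) * ((\<Sum>(i,j)\<in>pairs. G E i i * G E j j) + (\<Sum>(i,j)\<in>pairs. (G E j i)\<^sup>2))"
    unfolding sum_distrib_left sum.distrib[symmetric] sum_subtractf[symmetric]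
    by (intro sum.cong refl) (auto simp: algebra_simps)
  have alg: "S / N + a * ((P + D) / M) = (S - b * Q + w * (P + Q2)) / N + b * Q / N + a * (D - Q2) / M"
    if "w / N = a / M" for S N P D M b Q w Q2 a :: complex
  proof -
    have "w * (P + Q2) / N = a * (P + Q2) / M" using that by (metis times_divide_eq_left)
    then show ?thesis by (simp add: add_divide_distrib diff_divide_distrib algebra_simps)
  qed
  show ?thesis unfolding defect_def stieltjes_equation s2 1 by (rule alg[OF sq])
qed

lemma sum_G_pairs_norm: "norm (\<Sum>(i,j)\<in>pairs. G E j i) \<le> 2 * n / t"
proof -
  have "(\<Sum>(i,j)\<in>pairs. G E j i) = (\<Sum>i<n. \<Sum>j<n. G E i j) - (\<Sum>i<n. G E i i)"
    unfolding sum_pairs by (simp add: G_sym[of E])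
  moreover have "norm (\<Sum>i<n. \<Sum>j<n. G E i j) \<le> n / t"
    unfolding G_def by (rule resolvent_total_norm[OF eig t])
  moreover have "norm (\<Sum>i<n. G E i i) \<le> (\<Sum>i<n. 1 / t)" by (intro sum_norm_le G_norm) auto
  ultimately show ?thesis
    using norm_triangle_ineq4[of "\<Sum>i<n. \<Sum>j<n. G E i j" "\<Sum>i<n. G E i i"] by simp
qed

lemma sum_G_square_norm: "norm ((\<Sum>i<n. (G E i i)\<^sup>2) - (\<Sum>(i,j)\<in>pairs. (G E j i)\<^sup>2)) \<le> n / t\<^sup>2"
proof -
  have "norm ((\<Sum>i<n. (G E i i)\<^sup>2) - (\<Sum>(i,j)\<in>pairs. (G E j i)\<^sup>2))
     \<le> norm (\<Sum>i<n. (G E i i)\<^sup>2) + norm (\<Sum>(i,j)\<in>pairs. (G E j i)\<^sup>2)" by (rule norm_triangle_ineq4)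
  also have "\<dots> \<le> (\<Sum>i<n. (norm (G E i i))\<^sup>2) + (\<Sum>(i,j)\<in>pairs. (norm (G E i j))\<^sup>2)"
    by (intro add_mono sum_norm_le) (auto simp: norm_power G_sym[of E])
  also have "\<dots> = (\<Sum>i<n. \<Sum>j<n. (norm (G E i j))\<^sup>2)" unfolding sum_pairs by simp
  also have "\<dots> \<le> (\<Sum>i<n. 1 / t\<^sup>2)"
    unfolding G_def by (intro sum_mono resolvent_row_norm[OF eig t]) auto
  finally show ?thesis by simp
qed

text \<open>
  Each of the fewer than \<open>n\<^sup>2\<close> pairs contributes \<open>O(1 / n)\<close>, with the weight \<open>1 / (n sqrt n)\<close>; the two
  remaining terms of \<open>defect_expansion\<close> are bounded for every single graph. The test function \<open>F\<close> is
  what turns a statement on the mean of the defect into one on its fluctuations.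
\<close>
lemma loop_equation:
  fixes F :: "nat set set \<Rightarrow> complex"
  assumes L0: "L \<ge> 0" and K: "\<And>E. norm (F E) \<le> K"
    and L: "\<And>E i j. i < n \<Longrightarrow> j < n \<Longrightarrow> i \<noteq> j \<Longrightarrow> norm (F (E - {{i,j}}) - F (insert {i,j} E)) \<le> L / n"
  shows "norm (ER_expectation n p (\<lambda>E. defect E * F E))
    \<le> (\<tau>2 * (2 * L / t\<^sup>2 + 8 * K / t ^ 3 + L / t) + 6 * K / t + \<tau>2 * K / t\<^sup>2) / sqrt n"
proof -
  define C where "C = \<tau>2 * (2 * L / t\<^sup>2 + 8 * K / t ^ 3 + L / t)"
  have K0: "K \<ge> 0" using K[of "{}"] norm_ge_zero order_trans by blast
  define T where "T i j E = of_real (edge_weight E {i,j} - (3 - 2 * p)) * (G E j i * F E)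
      + of_real (\<tau>2 / sqrt n) * ((G E i i * G E j j + (G E j i)\<^sup>2) * F E)" for i j E
  define R1 where "R1 E = of_real (3 - 2 * p) * (\<Sum>(i,j)\<in>pairs. G E j i) / of_real (n * sqrt n) * F E" for E
  define R2 where "R2 E = of_real \<tau>2 * ((\<Sum>i<n. (G E i i)\<^sup>2) - (\<Sum>(i,j)\<in>pairs. (G E j i)\<^sup>2)) / (of_nat n)\<^sup>2 * F E" for E
  have split: "defect E * F E = (\<Sum>(i,j)\<in>pairs. T i j E) / of_real (n * sqrt n) + R1 E + R2 E" for E
  proof -
    have "(\<Sum>(i,j)\<in>pairs. T i j E) = (\<Sum>(i,j)\<in>pairs. of_real (edge_weight E {i,j} - (3 - 2 * p)) * G E j i
                 + of_real (\<tau>2 / sqrt n) * (G E i i * G E j j + (G E j i)\<^sup>2)) * F E"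
      unfolding sum_distrib_right T_def by (intro sum.cong refl) (auto simp: algebra_simps)
    then show ?thesis unfolding defect_expansion R1_def R2_def
      by (simp only: distrib_right times_divide_eq_left)
  qed
  have TE: "norm (ER_expectation n p (\<lambda>E. (\<Sum>(i,j)\<in>pairs. T i j E) / of_real (n * sqrt n))) \<le> C / sqrt n"
  proof -
    have "ER_expectation n p (\<lambda>E. (\<Sum>(i,j)\<in>pairs. T i j E) / of_real (n * sqrt n))
        = (\<Sum>x\<in>pairs. ER_expectation n p (T (fst x) (snd x))) / of_real (n * sqrt n)"
      by (subst integral_divide_zero, subst Bochner_Integration.integral_sum) (auto simp: case_prod_beta)
    also have "norm \<dots> = norm (\<Sum>x\<in>pairs. ER_expectation n p (T (fst x) (snd x))) / (n * sqrt n)"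
      by (simp add: norm_divide norm_mult)
    also have "\<dots> \<le> (\<Sum>x\<in>pairs. C / n) / (n * sqrt n)"
    proof (intro divide_right_mono sum_norm_le)
      fix x assume "x \<in> pairs"
      then have "fst x < n" "snd x < n" "fst x \<noteq> snd x" by (auto simp: pairs_def)
      then show "norm (ER_expectation n p (T (fst x) (snd x))) \<le> C / n"
        unfolding T_def C_def by (intro pair_expectation K L)
    qed simp
    also have "\<dots> \<le> (n\<^sup>2 * (C / n)) / (n * sqrt n)"
    proof (intro divide_right_mono)
      have "0 \<le> C" unfolding C_def using K0 L0 t p by (intro mult_nonneg_nonneg add_nonneg_nonneg) auto
      moreover have "real (card pairs) \<le> n\<^sup>2" using card_pairs by (rule of_nat_mono)
      ultimately have "real (card pairs) * (C / n) \<le> n\<^sup>2 * (C / n)" by (intro mult_right_mono) auto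
      then show "(\<Sum>x\<in>pairs. C / n) \<le> n\<^sup>2 * (C / n)" by simp
    qed simp
    also have "\<dots> = C / sqrt n" using n by (simp add: power2_eq_square)
    finally show ?thesis .
  qed
  have R1: "norm (R1 E) \<le> 6 * K / t / sqrt n" for E
  proof -
    have "norm (of_real (3 - 2 * p) :: complex) \<le> 3" using p unfolding norm_of_real by simp
    then have "norm (of_real (3 - 2 * p) * (\<Sum>(i,j)\<in>pairs. G E j i)) \<le> 3 * (2 * n / t)"
      unfolding norm_mult by (intro mult_mono sum_G_pairs_norm) auto
    then have "norm (of_real (3 - 2 * p) * (\<Sum>(i,j)\<in>pairs. G E j i)) / (n * sqrt n) * norm (F E) \<le> 3 * (2 * n / t) / (n * sqrt n) * K"
      using t by (intro mult_mono divide_right_mono K) auto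
    moreover have "3 * (2 * n / t) / (n * sqrt n) * K = 6 * K / t / sqrt n" using n by (simp add: field_simps)
    moreover have "norm (complex_of_real (n * sqrt n)) = n * sqrt n" unfolding norm_of_real by simp
    ultimately show ?thesis unfolding R1_def norm_mult[of _ "F E"] norm_divide by simp
  qed
  have R2: "norm (R2 E) \<le> \<tau>2 * K / t\<^sup>2 / sqrt n" for E
  proof -
    have "norm (of_real \<tau>2 :: complex) = \<tau>2" using tau2 by (simp only: norm_of_real abs_of_nonneg)
    then have "norm (of_real \<tau>2 * ((\<Sum>i<n. (G E i i)\<^sup>2) - (\<Sum>(i,j)\<in>pairs. (G E j i)\<^sup>2))) \<le> \<tau>2 * (n / t\<^sup>2)"
      unfolding norm_mult using tau2 by (simp only:) (intro mult_left_mono sum_G_square_norm)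
    note b = this
    have "norm (R2 E) \<le> \<tau>2 * (n / t\<^sup>2) / (real n)\<^sup>2 * K"
      unfolding R2_def norm_mult[of _ "F E"] norm_divide norm_power norm_of_nat
      by (intro mult_mono divide_right_mono K b) (use t p in auto)
    also have "\<dots> = \<tau>2 * K / t\<^sup>2 / n" using n by (simp add: power2_eq_square)
    also have "\<dots> \<le> \<tau>2 * K / t\<^sup>2 / sqrt n"
    proof (intro divide_left_mono)
      have "sqrt n * 1 \<le> sqrt n * sqrt n" using sqrt_n by (intro mult_left_mono) auto
      then show "sqrt n \<le> n" by simp
    qed (use n tau2 K0 in auto)
    finally show ?thesis .
  qed
  have "ER_expectation n p (\<lambda>E. defect E * F E)
     = ER_expectation n p (\<lambda>E. (\<Sum>(i,j)\<in>pairs. T i j E) / of_real (n * sqrt n)) + ER_expectation n p R1 + ER_expectation n p R2"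
    unfolding split by (subst Bochner_Integration.integral_add integrable_erdos_renyi, simp, simp)+ simp
  also have "norm \<dots> \<le> C / sqrt n + 6 * K / t / sqrt n + \<tau>2 * K / t\<^sup>2 / sqrt n"
  proof (intro norm_triangle_mono TE)
    have "norm (ER_expectation n p R1) \<le> ER_expectation n p (\<lambda>E. norm (R1 E))" by (rule integral_norm_bound)
    also have "\<dots> \<le> ER_expectation n p (\<lambda>E. 6 * K / t / sqrt n)"
      by (intro integral_mono integrable_erdos_renyi R1)
    finally show "norm (ER_expectation n p R1) \<le> 6 * K / t / sqrt n" by simp
    have "norm (ER_expectation n p R2) \<le> ER_expectation n p (\<lambda>E. norm (R2 E))" by (rule integral_norm_bound)
    also have "\<dots> \<le> ER_expectation n p (\<lambda>E. \<tau>2 * K / t\<^sup>2 / sqrt n)"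
      by (intro integral_mono integrable_erdos_renyi R2)
    finally show "norm (ER_expectation n p R2) \<le> \<tau>2 * K / t\<^sup>2 / sqrt n" by simp
  qed
  finally show ?thesis unfolding C_def by (simp only: add_divide_distrib)
qed

end

text \<open>
  The constant of \<open>loop_equation\<close> for the test function \<open>cnj (defect E)\<close>. What matters is that it does
  not involve \<open>n\<close>.
\<close>
definition defect_const :: "real \<Rightarrow> real \<Rightarrow> real" where
  "defect_const p t =
     (let v = 4 * p * (1 - p); K = 2 + v / t\<^sup>2; L = 4 / t\<^sup>2 * (t + 2 * v / t)
      in v * (2 * L / t\<^sup>2 + 8 * K / t ^ 3 + L / t) + 6 * K / t + v * K / t\<^sup>2)"

text \<open>
  The conjugate of the defect is bounded and changes by \<open>O(1 / n)\<close> with an edge, so the loop equation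
  admits it as test function.
\<close>
lemma (in scaled_resolvent) defect_second_moment:
  "ER_expectation n p (\<lambda>E. (norm (defect E))\<^sup>2) \<le> defect_const p t / sqrt n"
proof -
  define K where "K = 2 + \<tau>2 / t\<^sup>2"
  define L where "L = 4 / t\<^sup>2 * (t + 2 * \<tau>2 / t)"
  have L0: "L \<ge> 0" unfolding L_def using t p by (intro mult_nonneg_nonneg add_nonneg_nonneg) auto
  have K: "norm (cnj (defect E)) \<le> K" for E
    using defect_norm[of E] by (simp add: K_def)
  have L: "norm (cnj (defect (E - {{i,j}})) - cnj (defect (insert {i,j} E))) \<le> L / n"
    if "i < n" "j < n" "i \<noteq> j" for E i j
    using defect_flip_norm[OF that, of E] unfolding L_def complex_cnj_diff[symmetric] complex_mod_cnj .
  have "ER_expectation n p (\<lambda>E. defect E * cnj (defect E)) = of_real (ER_expectation n p (\<lambda>E. (norm (defect E))\<^sup>2))"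
    unfolding complex_norm_square[symmetric] by (rule integral_complex_of_real)
  then have "ER_expectation n p (\<lambda>E. (norm (defect E))\<^sup>2) \<le> norm (ER_expectation n p (\<lambda>E. defect E * cnj (defect E)))"
    by simp
  also have "\<dots> \<le> (\<tau>2 * (2 * L / t\<^sup>2 + 8 * K / t ^ 3 + L / t) + 6 * K / t + \<tau>2 * K / t\<^sup>2) / sqrt n"
    by (rule loop_equation[OF L0 K L])
  finally show ?thesis unfolding defect_const_def K_def L_def Let_def .
qed

text \<open>
  With \<open>y = (sqrt (t\<^sup>2 + 4 v) - t) / (2 v)\<close>, the Stieltjes transform of the semicircle law of variance \<open>v\<close>
  at \<open>\<i> t\<close> is \<open>\<i> y\<close>; this is \<open>1 - t y\<close>, the limit of \<open>coulson_mean\<close> below.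
\<close>
definition coulson_limit :: "real \<Rightarrow> real \<Rightarrow> real" where
  "coulson_limit v t = 1 - t * ((sqrt (t\<^sup>2 + 4 * v) - t) / (2 * v))"

text \<open>
  The quadratic factors as \<open>v (w - \<i> y) (w - \<i> z)\<close> with \<open>z \<le> - t / v\<close>. A point \<open>w\<close> of the closed upper half
  plane keeps the distance \<open>t / v\<close> from the second root, so a small value forces \<open>w\<close> to be close
  to the first one.
\<close>
lemma semicircle_root_stability:
  assumes v: "v > 0" and t: "t > 0" and w: "Im w \<ge> 0"
  shows "\<bar>(1 - t * Im w) - coulson_limit v t\<bar> \<le> norm (1 + \<i> * of_real t * w + of_real v * w\<^sup>2)"
proof -
  define q where "q = sqrt (t\<^sup>2 + 4 * v)"
  have q2: "q * q = t\<^sup>2 + 4 * v" unfolding q_def using v by simp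
  have q0: "q \<ge> t" unfolding q_def using v t by (intro real_le_rsqrt) auto
  define y where "y = (q - t) / (2 * v)"
  define z where "z = (- q - t) / (2 * v)"
  have yz: "v * (y * z) = -1" "v * (y + z) = - t"
  proof -
    have "4 * v * (v * (y * z)) = (q - t) * (- q - t)" using v by (simp add: y_def z_def)
    also have "\<dots> = 4 * v * (-1)" using q2 by (simp add: algebra_simps power2_eq_square)
    finally show "v * (y * z) = -1" using v by (subst (asm) mult_left_cancel) auto
    show "v * (y + z) = - t" using v by (simp add: y_def z_def field_simps)
  qed
  have "of_real v * ((w - \<i> * of_real y) * (w - \<i> * of_real z)) =
      of_real v * w\<^sup>2 - \<i> * of_real (v * (y + z)) * w - of_real (v * (y * z))"
    by (simp add: algebra_simps power2_eq_square)
  then have eq: "1 + \<i> * of_real t * w + of_real v * w\<^sup>2 = of_real v * ((w - \<i> * of_real y) * (w - \<i> * of_real z))"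
    unfolding yz by simp
  have "\<bar>Im w - y\<bar> \<le> norm (w - \<i> * of_real y)" using abs_Im_le_cmod[of "w - \<i> * of_real y"] by simp
  moreover have "t / v \<le> norm (w - \<i> * of_real z)"
  proof -
    have "t / v \<le> - z" using q0 v by (simp add: z_def field_simps)
    also have "\<dots> \<le> \<bar>Im (w - \<i> * of_real z)\<bar>" using w by simp
    also have "\<dots> \<le> norm (w - \<i> * of_real z)" by (rule abs_Im_le_cmod)
    finally show ?thesis .
  qed
  ultimately have "v * (\<bar>Im w - y\<bar> * (t / v)) \<le> v * (norm (w - \<i> * of_real y) * norm (w - \<i> * of_real z))"
    using v t by (intro mult_left_mono mult_mono) auto
  also have "\<dots> = norm (1 + \<i> * of_real t * w + of_real v * w\<^sup>2)" unfolding eq norm_mult using v by simp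
  finally have "t * \<bar>Im w - y\<bar> \<le> norm (1 + \<i> * of_real t * w + of_real v * w\<^sup>2)" using v by (simp add: mult.commute)
  moreover have "\<bar>(1 - t * Im w) - coulson_limit v t\<bar> = t * \<bar>Im w - y\<bar>"
  proof -
    have "(1 - t * Im w) - coulson_limit v t = - (t * (Im w - y))"
      unfolding coulson_limit_def q_def[symmetric] y_def[symmetric] by (simp add: algebra_simps)
    then show ?thesis using t by (simp add: abs_mult)
  qed
  ultimately show ?thesis by simp
qed

text \<open>
  Coulson's integrand averaged over the eigenvalues.
\<close>
definition coulson_mean :: "nat \<Rightarrow> (nat \<Rightarrow> real) \<Rightarrow> real \<Rightarrow> real" where
  "coulson_mean n lam t = (\<Sum>k<n. (lam k)\<^sup>2 / ((lam k)\<^sup>2 + t\<^sup>2)) / n"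

context scaled_resolvent
begin

lemma Im_stieltjes: "Im (stieltjes E) = (\<Sum>k<n. t / ((lam E k)\<^sup>2 + t\<^sup>2)) / n"
proof -
  have "Im (stieltjes E) = (\<Sum>k<n. Im (1 / (of_real (lam E k) - \<i> * of_real t))) / n"
    unfolding stieltjes_def G_def resolvent_trace[OF eig]
    by (simp add: Im_divide_of_nat)
  moreover have "Im (1 / (complex_of_real x - \<i> * of_real t)) = t / (x\<^sup>2 + t\<^sup>2)" for x
    by (simp add: Im_divide)
  ultimately show ?thesis by simp
qed

lemma coulson_mean_stieltjes: "coulson_mean n (lam E) t = 1 - t * Im (stieltjes E)"
proof -
  have pos: "(lam E k)\<^sup>2 + t\<^sup>2 > 0" for k using t by (simp add: add_nonneg_pos)
  have "(\<Sum>k<n. (lam E k)\<^sup>2 / ((lam E k)\<^sup>2 + t\<^sup>2)) = (\<Sum>k<n. 1 - t * (t / ((lam E k)\<^sup>2 + t\<^sup>2)))"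
    proof (intro sum.cong refl)
    fix k
    define d where "d = (lam E k)\<^sup>2 + t\<^sup>2"
    have "d > 0" "(lam E k)\<^sup>2 = d - t\<^sup>2" using pos[of k] by (auto simp: d_def)
    then show "(lam E k)\<^sup>2 / ((lam E k)\<^sup>2 + t\<^sup>2) = 1 - t * (t / ((lam E k)\<^sup>2 + t\<^sup>2))"
      unfolding d_def[symmetric] by (simp add: diff_divide_distrib power2_eq_square)
  qed
  also have "\<dots> = n - t * (\<Sum>k<n. t / ((lam E k)\<^sup>2 + t\<^sup>2))"
    by (simp add: sum_subtractf sum_distrib_left)
  finally show ?thesis using n unfolding coulson_mean_def Im_stieltjes by (simp add: diff_divide_distrib)
qed

text \<open>
  Stability of the root bounds the error by the modulus of the defect, and nonnegativity of the
  variance passes from the second moment to the first.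
\<close>
lemma coulson_mean_L1:
  assumes "0 < p" "p < 1"
  shows "ER_expectation n p (\<lambda>E. \<bar>coulson_mean n (lam E) t - coulson_limit \<tau>2 t\<bar>) \<le> sqrt (defect_const p t / sqrt n)"
proof -
  have Im: "Im (stieltjes E) \<ge> 0" for E unfolding Im_stieltjes using t by (intro divide_nonneg_nonneg sum_nonneg) auto
  have "ER_expectation n p (\<lambda>E. \<bar>coulson_mean n (lam E) t - coulson_limit \<tau>2 t\<bar>) \<le> ER_expectation n p (\<lambda>E. norm (defect E))"
    unfolding coulson_mean_stieltjes defect_def using assms t
    by (intro integral_mono integrable_erdos_renyi semicircle_root_stability Im) auto
  also have "\<dots> \<le> sqrt (ER_expectation n p (\<lambda>E. (norm (defect E))\<^sup>2))"
  proof (rule real_le_rsqrt)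
    have "0 \<le> measure_pmf.variance (erdos_renyi n p) (\<lambda>E. norm (defect E))"
      by (rule measure_pmf.variance_positive)
    also have "\<dots> = ER_expectation n p (\<lambda>E. (norm (defect E))\<^sup>2) - (ER_expectation n p (\<lambda>E. norm (defect E)))\<^sup>2"
      by (rule measure_pmf.variance_eq) auto
    finally show "(ER_expectation n p (\<lambda>E. norm (defect E)))\<^sup>2 \<le> ER_expectation n p (\<lambda>E. (norm (defect E))\<^sup>2)" by simp
  qed
  also have "\<dots> \<le> sqrt (defect_const p t / sqrt n)"
    by (intro real_sqrt_le_mono defect_second_moment)
  finally show ?thesis .
qed

end

section \<open>Coulson's integral and the mean absolute eigenvalue\<close>
lemma has_bochner_integral_FTC_atLeast:
  fixes f :: "real \<Rightarrow> real"
  assumes f: "f \<in> borel_measurable borel"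
    and F: "\<And>x. a \<le> x \<Longrightarrow> DERIV F x :> f x" and nonneg: "\<And>x. a \<le> x \<Longrightarrow> 0 \<le> f x"
    and lim: "(F \<longlongrightarrow> T) at_top"
  shows "has_bochner_integral lborel (\<lambda>x. indicator {a..} x * f x) (T - F a)"
proof (rule has_bochner_integral_nn_integral)
  have "mono_on {a..} F"
  proof (rule mono_onI)
    fix r s assume "r \<in> {a..}" "s \<in> {a..}" "r \<le> s"
    then show "F r \<le> F s" using F nonneg by (intro DERIV_nonneg_imp_nondecreasing[of r s F]) (auto intro: order_trans)
  qed
  then have "eventually (\<lambda>x. F a \<le> F x) at_top"
    by (intro eventually_mono[OF eventually_ge_at_top[of a]]) (auto simp: mono_on_def)
  then have "F a \<le> T" using lim by (intro tendsto_lowerbound[OF lim]) auto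
  then show "0 \<le> T - F a" by simp
  have "(\<integral>\<^sup>+x. ennreal (indicator {a..} x * f x) \<partial>lborel) = (\<integral>\<^sup>+x. ennreal (f x) * indicator {a..} x \<partial>lborel)"
    by (intro nn_integral_cong) (auto simp: indicator_def)
  also have "\<dots> = T - F a" by (rule nn_integral_FTC_atLeast[OF f F nonneg lim])
  finally show "(\<integral>\<^sup>+x. ennreal (indicator {a..} x * f x) \<partial>lborel) = ennreal (T - F a)" .
qed (use f nonneg in \<open>auto simp: indicator_def\<close>)

lemma tendsto_zero_squeeze:
  fixes f g :: "nat \<Rightarrow> real"
  assumes "g \<longlonglongrightarrow> 0" "eventually (\<lambda>n. f n \<le> g n) sequentially" "\<And>n. 0 \<le> f n"
  shows "f \<longlonglongrightarrow> 0"
  by (rule tendsto_sandwich[OF always_eventually assms(2) tendsto_const assms(1)]) (use assms(3) in blast)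

lemma coulson_integral:
  "has_bochner_integral lborel (\<lambda>t. indicator {0..} t * (x\<^sup>2 / (x\<^sup>2 + t\<^sup>2))) (pi / 2 * \<bar>x\<bar>)"
proof (cases "x = 0")
  case False
  define a where "a = \<bar>x\<bar>"
  have a: "a > 0" and xa: "x\<^sup>2 = a\<^sup>2" using False by (auto simp: a_def)
  have "has_bochner_integral lborel (\<lambda>t. indicator {0..} t * (a\<^sup>2 / (a\<^sup>2 + t\<^sup>2))) (pi / 2 * a - a * arctan (0 / a))"
  proof (rule has_bochner_integral_FTC_atLeast)
    fix t :: real
    have "a\<^sup>2 + t\<^sup>2 > 0" using a by (simp add: add_pos_nonneg)
    then show "((\<lambda>t. a * arctan (t / a)) has_real_derivative a\<^sup>2 / (a\<^sup>2 + t\<^sup>2)) (at t)"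
      using a by (auto intro!: derivative_eq_intros simp: field_simps power2_eq_square)
  next
    show "((\<lambda>t. a * arctan (t / a)) \<longlongrightarrow> pi / 2 * a) at_top"
      using a by real_asymp
  qed auto
  then show ?thesis unfolding xa a_def by simp
qed (simp add: has_bochner_integral_zero)

text \<open>
  With \<open>q = sqrt (t\<^sup>2 + 4 v)\<close> the claim \<open>t (q - t) \<le> 2 v\<close> is the inequality \<open>2 t q \<le> t\<^sup>2 + q\<^sup>2\<close>.
\<close>
lemma coulson_limit_nonneg:
  assumes "v > 0" "t \<ge> 0"
  shows "coulson_limit v t \<ge> 0"
proof -
  define q where "q = sqrt (t\<^sup>2 + 4 * v)"
  have q2: "q * q = t * t + 4 * v" unfolding q_def using assms by (simp add: power2_eq_square)
  have "t * q \<le> (t * t + q * q) / 2" using sum_squares_bound[of t q] by (simp add: power2_eq_square)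
  then have "t * (q - t) \<le> 2 * v" using q2 by (simp add: algebra_simps)
  then have "t * (q - t) / (2 * v) \<le> 1" using assms by (simp add: divide_le_eq)
  then show ?thesis by (simp add: coulson_limit_def q_def)
qed

lemma coulson_limit_measurable [measurable]: "coulson_limit v \<in> borel_measurable borel"
  unfolding coulson_limit_def[abs_def] by measurable

lemma coulson_limit_integral:
  assumes v: "v > 0"
  shows "has_bochner_integral lborel (\<lambda>t. indicator {0..} t * coulson_limit v t) (4 * sqrt v / 3)"
proof -
  \<comment> \<open>An antiderivative of \<open>coulson_limit v\<close> that vanishes at infinity.\<close>
  define F where "F t = t + t ^ 3 / (6 * v) - (t\<^sup>2 + 4 * v) * sqrt (t\<^sup>2 + 4 * v) / (6 * v)" for t :: real
  have "has_bochner_integral lborel (\<lambda>t. indicator {0..} t * coulson_limit v t) (0 - F 0)"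
  proof (rule has_bochner_integral_FTC_atLeast)
    fix t :: real
    define q where "q = sqrt (t\<^sup>2 + 4 * v)"
    have pos: "t\<^sup>2 + 4 * v > 0" using v by (simp add: add_nonneg_pos)
    then have q: "q > 0" "t\<^sup>2 + 4 * v = q * q" by (auto simp: q_def)
    have "(F has_real_derivative (1 + 3 * t\<^sup>2 / (6 * v) - (2 * t * q + (q * q) * (2 * t * (inverse q / 2))) / (6 * v))) (at t)"
      unfolding F_def using pos q v
      by (auto intro!: derivative_eq_intros simp: q_def[symmetric] mult_ac)
    moreover have "1 + 3 * t\<^sup>2 / (6 * v) - (2 * t * q + (q * q) * (2 * t * (inverse q / 2))) / (6 * v) = coulson_limit v t"
      using v q(1) unfolding coulson_limit_def q_def[symmetric] by (simp add: field_simps power2_eq_square)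
    ultimately show "(F has_real_derivative coulson_limit v t) (at t)" by simp
  next
    show "(F \<longlongrightarrow> 0) at_top" unfolding F_def using v by real_asymp
  qed (use v in \<open>auto simp: coulson_limit_nonneg\<close>)
  moreover have "0 - F 0 = 4 * sqrt v / 3" using v by (simp add: F_def real_sqrt_mult)
  ultimately show ?thesis by (simp only:)
qed

lemma coulson_mean_integral:
  "has_bochner_integral lborel (\<lambda>t. indicator {0..} t * coulson_mean n lam t) (pi / 2 * ((\<Sum>k<n. \<bar>lam k\<bar>) / n))"
proof -
  have "has_bochner_integral lborel (\<lambda>t. (\<Sum>k<n. indicator {0..} t * ((lam k)\<^sup>2 / ((lam k)\<^sup>2 + t\<^sup>2))) / n)
     ((\<Sum>k<n. pi / 2 * \<bar>lam k\<bar>) / n)"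
    by (intro has_bochner_integral_divide_zero has_bochner_integral_sum coulson_integral)
  then show ?thesis unfolding coulson_mean_def by (simp add: sum_distrib_left)
qed

text \<open>
  The function \<open>x / (x + t\<^sup>2)\<close> is concave in \<open>x\<close>, so by Jensen's inequality its mean is at most its
  value at an upper bound for the mean of the \<open>x = (lam k)\<^sup>2\<close>.
\<close>
lemma coulson_mean_le:
  assumes a: "a > 0" and t: "t \<noteq> 0" and le: "(\<Sum>k<n. (lam k)\<^sup>2) \<le> a * n"
  shows "coulson_mean n lam t \<le> a / (a + t\<^sup>2)"
proof (cases "n = 0")
  case False
  define T where "T = t\<^sup>2"
  have T: "T > 0" using t by (simp add: T_def)
  \<comment> \<open>The tangent at \<open>a\<close> lies above the graph of a concave function.\<close>
  have tangent: "x / (x + T) \<le> a / (a + T) + (x - a) * (T / (a + T)\<^sup>2)" if x: "x \<ge> 0" for x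
  proof -
    have "a / (a + T) + (x - a) * (T / (a + T)\<^sup>2) - x / (x + T) = T * (x - a)\<^sup>2 / ((x + T) * (a + T)\<^sup>2)"
      using a x T by (simp add: divide_simps add_pos_pos add_nonneg_pos) (simp add: algebra_simps power2_eq_square)
    also have "\<dots> \<ge> 0" using a x T by auto
    finally show ?thesis by simp
  qed
  have "(\<Sum>k<n. (lam k)\<^sup>2 / ((lam k)\<^sup>2 + T)) \<le> (\<Sum>k<n. a / (a + T) + ((lam k)\<^sup>2 - a) * (T / (a + T)\<^sup>2))"
    by (intro sum_mono tangent) auto
  also have "\<dots> = n * (a / (a + T)) + ((\<Sum>k<n. (lam k)\<^sup>2) - a * n) * (T / (a + T)\<^sup>2)"
    unfolding sum.distrib sum_distrib_right[symmetric] sum_subtractf by (simp add: mult.commute)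
  also have "\<dots> \<le> n * (a / (a + T)) + 0"
    using le T a by (intro add_left_mono mult_nonpos_nonneg) auto
  finally have "(\<Sum>k<n. (lam k)\<^sup>2 / ((lam k)\<^sup>2 + T)) / n \<le> (n * (a / (a + T))) / n"
    by (intro divide_right_mono) auto
  then show ?thesis using False by (simp add: coulson_mean_def T_def)
qed (use a in \<open>simp add: coulson_mean_def\<close>)

lemma coulson_mean_nonneg: "coulson_mean n lam t \<ge> 0"
  unfolding coulson_mean_def by (intro divide_nonneg_nonneg sum_nonneg) auto

lemma coulson_mean_measurable [measurable]: "coulson_mean n lam \<in> borel_measurable borel"
  unfolding coulson_mean_def[abs_def] by measurable

lemma eigensystem_frobenius:
  assumes M: "eigensystem n M lam u"
  shows "(\<Sum>k<n. (lam k)\<^sup>2) = (\<Sum>i<n. \<Sum>j<n. (M i j)\<^sup>2)"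
proof -
  have "(\<Sum>i<n. \<Sum>j<n. (M i j)\<^sup>2) = (\<Sum>i<n. \<Sum>j<n. \<Sum>k<n. lam k * u k i * (M i j * u k j))"
  proof (intro sum.cong refl)
    fix i j assume "i \<in> {..<n}" "j \<in> {..<n}"
    then have "M i j * M i j = M i j * (\<Sum>k<n. lam k * u k i * u k j)" using M by (simp add: eigensystem_def)
    then show "(M i j)\<^sup>2 = (\<Sum>k<n. lam k * u k i * (M i j * u k j))"
      by (simp add: power2_eq_square sum_distrib_left mult_ac)
  qed
  also have "\<dots> = (\<Sum>i<n. \<Sum>k<n. lam k * u k i * (\<Sum>j<n. M i j * u k j))"
    unfolding sum_distrib_left by (rule sum.cong[OF refl], rule sum.swap)
  also have "\<dots> = (\<Sum>i<n. \<Sum>k<n. (lam k)\<^sup>2 * (u k i * u k i))"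
    using eigensystem_eigenvector[OF M] by (intro sum.cong refl) (simp add: power2_eq_square mult_ac)
  also have "\<dots> = (\<Sum>k<n. (lam k)\<^sup>2 * (\<Sum>i<n. u k i * u k i))"
    unfolding sum_distrib_left by (rule sum.swap)
  also have "\<dots> = (\<Sum>k<n. (lam k)\<^sup>2)" using eigensystem_orthonormal[OF M] by (intro sum.cong refl) simp
  finally show ?thesis ..
qed

lemma scaled_mat_frobenius: "(\<Sum>i<n. \<Sum>j<n. (scaled_mat n E i j)\<^sup>2) \<le> 9 * n"
proof (cases "n = 0")
  case False
  have "(\<Sum>i<n. \<Sum>j<n. (scaled_mat n E i j)\<^sup>2) \<le> (\<Sum>i<n. \<Sum>j<n. 9 / real n)"
    using False by (intro sum_mono) (auto simp: scaled_mat_def edge_weight_def power_divide divide_right_mono)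
  then show ?thesis using False by simp
qed simp

text \<open>
  Coulson's integral turns the difference of the mean absolute eigenvalue and its limit into an
  integral over \<open>t\<close>. The expectation is a finite sum and moves inside; the expected integrand tends
  to \<open>0\<close> for every \<open>t > 0\<close> and is dominated by \<open>9 / (9 + t\<^sup>2)\<close> plus the limiting integrand.
\<close>
theorem mean_abs_eigenvalue_L1_limit:
  fixes lam :: "nat \<Rightarrow> nat set set \<Rightarrow> nat \<Rightarrow> real"
  assumes p: "0 < p" "p < 1"
    and eig: "\<And>n E. eigensystem n (scaled_mat n E) (lam n E) (u n E)"
  shows "(\<lambda>n. ER_expectation n p (\<lambda>E. \<bar>(\<Sum>k<n. \<bar>lam n E k\<bar>) / n - 16 / (3 * pi) * sqrt (p * (1 - p))\<bar>)) \<longlonglongrightarrow> 0"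
proof -
  define v where "v = 4 * p * (1 - p)"
  have v: "v > 0" using p by (simp add: v_def)
  define c where "c = 16 / (3 * pi) * sqrt (p * (1 - p))"
  have c: "c = 2 / pi * (4 * sqrt v / 3)"
  proof -
    have "sqrt v = 2 * sqrt (p * (1 - p))" unfolding v_def by (simp add: real_sqrt_mult)
    then show ?thesis unfolding c_def by simp
  qed
  define g where "g n E t = indicator {0..} t * \<bar>coulson_mean n (lam n E) t - coulson_limit v t\<bar>" for n E and t :: real
  define f where "f n t = ER_expectation n p (\<lambda>E. g n E t)" for n t
  define w where "w t = indicator {0..} t * (3\<^sup>2 / (3\<^sup>2 + t\<^sup>2)) + indicator {0..} t * coulson_limit v t" for t :: real
  have intw: "integrable lborel w" unfolding w_def
    using coulson_integral[of 3] coulson_limit_integral[OF v] by (intro Bochner_Integration.integrable_add) (auto simp: has_bochner_integral_iff)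
  have gw: "g n E t \<le> w t" if "t \<noteq> 0" for n E t
  proof (cases "t \<ge> 0")
    case True
    have "(\<Sum>k<n. (lam n E k)\<^sup>2) \<le> 9 * n" using scaled_mat_frobenius eigensystem_frobenius[OF eig] by simp
    then have "coulson_mean n (lam n E) t \<le> 9 / (9 + t\<^sup>2)" using that by (intro coulson_mean_le) auto
    then show ?thesis using True coulson_mean_nonneg[of n "lam n E" t] coulson_limit_nonneg[OF v True]
      by (simp add: g_def w_def)
  qed (simp add: g_def w_def)
  have g_int: "integrable lborel (g n E)" for n E
  proof -
    have "integrable lborel (\<lambda>t. \<bar>indicator {0..} t * coulson_mean n (lam n E) t - indicator {0..} t * coulson_limit v t\<bar>)"
      using coulson_mean_integral[of n "lam n E"] coulson_limit_integral[OF v]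
      by (intro integrable_abs Bochner_Integration.integrable_diff) (auto simp: has_bochner_integral_iff)
    then show ?thesis unfolding g_def by (simp add: right_diff_distrib[symmetric] abs_mult)
  qed
  have f_eq: "f n t = (\<Sum>E\<in>set_pmf (erdos_renyi n p). pmf (erdos_renyi n p) E * g n E t)" for n t
    unfolding f_def by (subst integral_measure_pmf[OF finite_set_erdos_renyi]) auto
  have f_int: "integral\<^sup>L lborel (f n) = ER_expectation n p (\<lambda>E. integral\<^sup>L lborel (g n E))" for n
    unfolding f_eq[abs_def] using g_int
    by (subst Bochner_Integration.integral_sum) (auto simp: integral_measure_pmf[OF finite_set_erdos_renyi])
  have "(\<lambda>n. integral\<^sup>L lborel (f n)) \<longlonglongrightarrow> integral\<^sup>L lborel (\<lambda>t :: real. 0 :: real)"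
  proof (rule Bochner_Integration.integral_dominated_convergence[where w = w])
    show "f n \<in> borel_measurable lborel" for n
      unfolding f_eq[abs_def] g_def by measurable
    show "AE t in lborel. (\<lambda>n. f n t) \<longlonglongrightarrow> 0"
      using AE_lborel_singleton[of 0]
    proof eventually_elim
      case (elim t)
      show ?case
      proof (cases "t > 0")
        case True
        have bound: "f n t \<le> sqrt (defect_const p t / sqrt n)" if "n \<ge> 1" for n
        proof -
          interpret scaled_resolvent n p t "lam n" "u n"
            using that p True eig by unfold_locales auto
          show ?thesis using coulson_mean_L1[OF assms(1,2)] True by (simp add: f_def g_def v_def)
        qed
        have "(\<lambda>n. 1 / sqrt (real n)) \<longlonglongrightarrow> 0" by real_asymp
        from tendsto_real_sqrt[OF tendsto_mult[OF tendsto_const[of "defect_const p t"] this]]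
        have "(\<lambda>n. sqrt (defect_const p t / sqrt (real n))) \<longlonglongrightarrow> 0" by simp
        moreover have "eventually (\<lambda>n. f n t \<le> sqrt (defect_const p t / sqrt n)) sequentially"
          using eventually_ge_at_top[of 1] by eventually_elim (rule bound)
        moreover have "f n t \<ge> 0" for n unfolding f_def g_def by (intro integral_nonneg_AE) auto
        ultimately show ?thesis
          by (rule tendsto_zero_squeeze)
      next
        case False
        then show ?thesis using elim by (simp add: f_def g_def)
      qed
    qed
    show "AE t in lborel. norm (f n t) \<le> w t" for n
      using AE_lborel_singleton[of 0]
    proof eventually_elim
      case (elim t)
      have "f n t \<ge> 0" unfolding f_def g_def by (intro integral_nonneg_AE) auto
      moreover have "f n t \<le> ER_expectation n p (\<lambda>E. w t)"
        unfolding f_def by (intro integral_mono integrable_erdos_renyi gw elim)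
      ultimately show ?case by simp
    qed
  qed (use intw in auto)
  then have "(\<lambda>n. 2 / pi * integral\<^sup>L lborel (f n)) \<longlonglongrightarrow> 2 / pi * 0"
    by (intro tendsto_mult tendsto_const) simp
  then have lim: "(\<lambda>n. 2 / pi * integral\<^sup>L lborel (f n)) \<longlonglongrightarrow> 0" by simp
  have "\<bar>(\<Sum>k<n. \<bar>lam n E k\<bar>) / n - c\<bar> \<le> 2 / pi * integral\<^sup>L lborel (g n E)" for n E
  proof -
    have "has_bochner_integral lborel (\<lambda>t. indicator {0..} t * coulson_mean n (lam n E) t - indicator {0..} t * coulson_limit v t)
      (pi / 2 * ((\<Sum>k<n. \<bar>lam n E k\<bar>) / n) - 4 * sqrt v / 3)"
      by (intro has_bochner_integral_diff coulson_mean_integral coulson_limit_integral v)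
    then have "\<bar>pi / 2 * ((\<Sum>k<n. \<bar>lam n E k\<bar>) / n) - 4 * sqrt v / 3\<bar> =
       norm (integral\<^sup>L lborel (\<lambda>t. indicator {0..} t * coulson_mean n (lam n E) t - indicator {0..} t * coulson_limit v t))"
      by (simp add: has_bochner_integral_iff)
    also have "\<dots> \<le> integral\<^sup>L lborel (\<lambda>t. norm (indicator {0..} t * coulson_mean n (lam n E) t - indicator {0..} t * coulson_limit v t))"
      by (rule integral_norm_bound)
    also have "\<dots> = integral\<^sup>L lborel (g n E)"
      unfolding g_def by (simp add: right_diff_distrib[symmetric] abs_mult)
    finally have le: "2 / pi * \<bar>pi / 2 * ((\<Sum>k<n. \<bar>lam n E k\<bar>) / n) - 4 * sqrt v / 3\<bar> \<le> 2 / pi * integral\<^sup>L lborel (g n E)"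
      by (intro mult_left_mono) auto
    have eq: "(\<Sum>k<n. \<bar>lam n E k\<bar>) / n - c = 2 / pi * (pi / 2 * ((\<Sum>k<n. \<bar>lam n E k\<bar>) / n) - 4 * sqrt v / 3)"
      unfolding c by (simp add: right_diff_distrib)
    have pos: "\<bar>2 / pi\<bar> = 2 / pi" by simp
    show ?thesis using le unfolding eq abs_mult pos .
  qed
  then have le: "ER_expectation n p (\<lambda>E. \<bar>(\<Sum>k<n. \<bar>lam n E k\<bar>) / n - c\<bar>) \<le> 2 / pi * integral\<^sup>L lborel (f n)" for n
    unfolding f_int integral_mult_right_zero[symmetric] by (intro integral_mono integrable_erdos_renyi)
  have "(\<lambda>n. ER_expectation n p (\<lambda>E. \<bar>(\<Sum>k<n. \<bar>lam n E k\<bar>) / n - c\<bar>)) \<longlonglongrightarrow> 0"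
  proof (rule tendsto_zero_squeeze[OF lim])
    show "\<forall>\<^sub>F n in sequentially. ER_expectation n p (\<lambda>E. \<bar>(\<Sum>k<n. \<bar>lam n E k\<bar>) / n - c\<bar>) \<le> 2 / pi * integral\<^sup>L lborel (f n)"
      by (intro always_eventually allI le)
    show "0 \<le> ER_expectation n p (\<lambda>E. \<bar>(\<Sum>k<n. \<bar>lam n E k\<bar>) / n - c\<bar>)" for n
      by (intro integral_nonneg_AE) auto
  qed
  then show ?thesis unfolding c_def .
qed

section \<open>Common neighbours and diameter two\<close>
definition common_neighbour :: "nat set set \<Rightarrow> nat \<Rightarrow> nat \<Rightarrow> nat \<Rightarrow> bool" where
  "common_neighbour E i j k \<longleftrightarrow> {i, k} \<in> E \<and> {j, k} \<in> E"

text \<open>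
  For different \<open>k\<close> the events depend on disjoint pairs of edges. The induction redraws the two edges
  from \<open>k\<close>, which leaves the remaining product \<open>\<Phi>\<close> unchanged.
\<close>
lemma no_common_neighbour_prob:
  assumes p: "0 \<le> p" "p \<le> 1" and ij: "i < n" "j < n" "i \<noteq> j" and K: "finite K" "K \<subseteq> {..<n} - {i, j}"
  shows "ER_expectation n p (\<lambda>E. \<Prod>k\<in>K. of_bool (\<not> common_neighbour E i j k)) = (1 - p\<^sup>2) ^ card K"
  using K
proof (induction K rule: finite_induct)
  case (insert k K)
  define \<Phi> :: "nat set set \<Rightarrow> real" where "\<Phi> E = (\<Prod>k\<in>K. of_bool (\<not> common_neighbour E i j k))" for E
  have k: "k < n" "k \<noteq> i" "k \<noteq> j" using insert by auto
  have e: "{i,k} \<in> all_edges n" "{j,k} \<in> all_edges n" using ij k by (auto simp: pair_in_all_edges)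
  have ne: "{i,k} \<noteq> {j,k}" using ij k by (auto simp: doubleton_eq_iff)
  have other: "{a,k'} \<noteq> {b,k}" if "a \<in> {i,j}" "b \<in> {i,j}" "k' \<in> K" for a b k'
  proof -
    have "k' \<noteq> k" "k' \<noteq> i" "k' \<noteq> j" using insert that by auto
    then show ?thesis using that k by (auto simp: doubleton_eq_iff)
  qed
  have \<Phi>_insert: "\<Phi> (insert {b,k} E) = \<Phi> E" and \<Phi>_remove: "\<Phi> (E - {{b,k}}) = \<Phi> E" if "b \<in> {i,j}" for b E
    unfolding \<Phi>_def common_neighbour_def using other[of _ b] that by (intro prod.cong refl; auto)+
  have "ER_expectation n p (\<lambda>E. of_bool (\<not> common_neighbour E i j k) * \<Phi> E) =
     ER_expectation n p (\<lambda>E. p * (of_bool ({j,k} \<notin> E) * \<Phi> E) + (1 - p) * \<Phi> E)"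
    by (subst erdos_renyi_resample_edge[OF p e(1)])
      (simp add: common_neighbour_def \<Phi>_insert \<Phi>_remove ne[symmetric])
  also have "\<dots> = p * ER_expectation n p (\<lambda>E. of_bool ({j,k} \<notin> E) * \<Phi> E) + (1 - p) * ER_expectation n p \<Phi>"
    by (subst Bochner_Integration.integral_add) auto
  also have "ER_expectation n p (\<lambda>E. of_bool ({j,k} \<notin> E) * \<Phi> E) = (1 - p) * ER_expectation n p \<Phi>"
    by (subst erdos_renyi_resample_edge[OF p e(2)]) (simp add: \<Phi>_insert \<Phi>_remove)
  finally have "ER_expectation n p (\<lambda>E. of_bool (\<not> common_neighbour E i j k) * \<Phi> E) = (1 - p\<^sup>2) * ER_expectation n p \<Phi>"
    by (simp add: algebra_simps power2_eq_square)
  then show ?case using insert unfolding \<Phi>_def by simp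
qed simp

text \<open>
  For a graph on \<open>{..<n}\<close>, the number of ordered pairs of distinct vertices without a common
  neighbour, written as a polynomial in the edge indicators so that expectations can be computed term
  by term.
\<close>
definition lonely_pairs :: "nat \<Rightarrow> nat set set \<Rightarrow> real" where
  "lonely_pairs n E = (\<Sum>i<n. \<Sum>j\<in>{..<n} - {i}. \<Prod>k\<in>{..<n} - {i,j}. of_bool (\<not> common_neighbour E i j k))"

lemma lonely_pairs_expectation:
  assumes p: "0 \<le> p" "p \<le> 1"
  shows "ER_expectation n p (lonely_pairs n) \<le> (real n)\<^sup>2 * (1 - p\<^sup>2) ^ (n - 2)"
proof -
  have "ER_expectation n p (lonely_pairs n) =
     (\<Sum>i<n. \<Sum>j\<in>{..<n} - {i}. ER_expectation n p (\<lambda>E. \<Prod>k\<in>{..<n} - {i,j}. of_bool (\<not> common_neighbour E i j k)))"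
    unfolding lonely_pairs_def[abs_def] by (simp add: Bochner_Integration.integral_sum)
  also have "\<dots> = (\<Sum>i<n. \<Sum>j\<in>{..<n} - {i}. (1 - p\<^sup>2) ^ (n - 2))"
  proof (intro sum.cong refl)
    fix i j assume "i \<in> {..<n}" "j \<in> {..<n} - {i}"
    then show "ER_expectation n p (\<lambda>E. \<Prod>k\<in>{..<n} - {i,j}. of_bool (\<not> common_neighbour E i j k)) = (1 - p\<^sup>2) ^ (n - 2)"
      by (subst no_common_neighbour_prob[OF p]) (auto simp: card_Diff_subset numeral_2_eq_2)
  qed
  also have "\<dots> = real n * real (n - 1) * (1 - p\<^sup>2) ^ (n - 2)"
  proof -
    have "(\<Sum>i<n. \<Sum>j\<in>{..<n} - {i}. (1 - p\<^sup>2) ^ (n - 2)) = (\<Sum>i<n. real (n - 1) * (1 - p\<^sup>2) ^ (n - 2))"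
      by (intro sum.cong refl) (simp add: card_Diff_subset)
    then show ?thesis by (simp only: sum_constant card_lessThan mult.assoc)
  qed
  also have "\<dots> \<le> real n * real n * (1 - p\<^sup>2) ^ (n - 2)"
    using p by (intro mult_right_mono mult_left_mono) (auto simp: power_le_one)
  finally show ?thesis by (simp add: power2_eq_square)
qed

text \<open>
  Up to a constant this is the square of \<open>n q^n\<close> with \<open>q = sqrt (1 - p\<^sup>2) < 1\<close>.
\<close>
lemma lonely_pairs_expectation_limit:
  assumes p: "0 < p" "p < 1"
  shows "(\<lambda>n. (real n)\<^sup>2 * (1 - p\<^sup>2) ^ (n - 2)) \<longlonglongrightarrow> 0"
proof -
  define q where "q = sqrt (1 - p\<^sup>2)"
  have "p\<^sup>2 < 1" "0 < p\<^sup>2" using p by (auto simp: power_less_one_iff abs_square_less_1)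
  then have q: "0 < q" "q < 1" and q2: "1 - p\<^sup>2 = q\<^sup>2" by (auto simp: q_def)
  have "(\<lambda>n. real n * q ^ n) \<longlonglongrightarrow> 0" using q by (intro powser_times_n_limit_0) auto
  then have "(\<lambda>n. (real n * q ^ n)\<^sup>2 / (q\<^sup>2)\<^sup>2) \<longlonglongrightarrow> 0\<^sup>2 / (q\<^sup>2)\<^sup>2"
    using q by (intro tendsto_intros) auto
  then have "(\<lambda>n. (real n * q ^ n)\<^sup>2 / (q\<^sup>2)\<^sup>2) \<longlonglongrightarrow> 0" by simp
  moreover have "eventually (\<lambda>n. (real n * q ^ n)\<^sup>2 / (q\<^sup>2)\<^sup>2 = (real n)\<^sup>2 * (1 - p\<^sup>2) ^ (n - 2)) sequentially"
    using eventually_ge_at_top[of 2]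
  proof eventually_elim
    case (elim n)
    then have "q ^ n = q\<^sup>2 * q ^ (n - 2)" by (metis le_add_diff_inverse power_add)
    then show ?case unfolding q2 using q by (simp add: power_mult_distrib power_mult[symmetric] mult.commute)
  qed
  ultimately show ?thesis by (rule Lim_transform_eventually)
qed

lemma lonely_pairs_nonneg: "lonely_pairs n E \<ge> 0"
  unfolding lonely_pairs_def by (intro sum_nonneg prod_nonneg) auto

lemma common_neighbour_exists:
  assumes "lonely_pairs n E < 1" and ij: "i < n" "j < n" "i \<noteq> j"
  shows "\<exists>k. common_neighbour E i j k"
proof (rule ccontr)
  assume "\<not> ?thesis"
  then have "1 = (\<Prod>k\<in>{..<n} - {i,j}. of_bool (\<not> common_neighbour E i j k) :: real)" by simp
  also have "\<dots> \<le> (\<Sum>j\<in>{..<n} - {i}. \<Prod>k\<in>{..<n} - {i,j}. of_bool (\<not> common_neighbour E i j k))"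
    using ij by (intro member_le_sum[of j] prod_nonneg) auto
  also have "\<dots> \<le> lonely_pairs n E"
    unfolding lonely_pairs_def using ij
    by (intro member_le_sum[of i _ "\<lambda>i. \<Sum>j\<in>{..<n} - {i}. \<Prod>k\<in>{..<n} - {i,j}. of_bool (\<not> common_neighbour E i j k)"] sum_nonneg prod_nonneg) auto
  finally show False using assms(1) by simp
qed

lemma graph_dist_self: "graph_dist E i i = 0"
  unfolding graph_dist_def by (auto intro!: Least_eq_0)

lemma graph_dist_common_neighbour:
  assumes ij: "i \<noteq> j" and k: "common_neighbour E i j k"
  shows "graph_dist E i j = (if {i, j} \<in> E then 1 else 2)"
proof -
  let ?R = "adj_rel E"
  have 0: "(i, j) \<notin> ?R ^^ 0" using ij by simp
  have 1: "(i, j) \<in> ?R ^^ 1 \<longleftrightarrow> {i, j} \<in> E" by (simp add: adj_rel_def)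
  have "(i, k) \<in> ?R" "(k, j) \<in> ?R" using k by (auto simp: common_neighbour_def adj_rel_def insert_commute)
  then have 2: "(i, j) \<in> ?R ^^ 2" by (auto simp: numeral_2_eq_2)
  have "(LEAST m. (i, j) \<in> ?R ^^ m) = (if {i, j} \<in> E then 1 else 2)"
  proof (rule Least_equality)
    show "(i, j) \<in> ?R ^^ (if {i, j} \<in> E then 1 else 2)" using 1 2 by simp
    fix m assume m: "(i, j) \<in> ?R ^^ m"
    then have "m \<noteq> 0" using 0 by (metis)
    moreover have "m \<noteq> 1" if "{i, j} \<notin> E" using m 1 that by (metis)
    ultimately show "(if {i, j} \<in> E then 1 else 2) \<le> m" by auto
  qed
  then show ?thesis unfolding graph_dist_def using 2 by auto
qed

lemma hyper_wiener_mat_eq: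
  assumes "lonely_pairs n E < 1"
  shows "hyper_wiener_mat n E = mat n n (\<lambda>(i, j). sqrt n * scaled_mat n E i j)"
proof (rule eq_matI)
  fix i j assume "i < dim_row (mat n n (\<lambda>(i, j). sqrt n * scaled_mat n E i j))"
    "j < dim_col (mat n n (\<lambda>(i, j). sqrt n * scaled_mat n E i j))"
  then have ij: "i < n" "j < n" by auto
  show "hyper_wiener_mat n E $$ (i, j) = mat n n (\<lambda>(i, j). sqrt n * scaled_mat n E i j) $$ (i, j)"
  proof (cases "i = j")
    case False
    then obtain k where "common_neighbour E i j k" using common_neighbour_exists[OF assms ij] by auto
    from graph_dist_common_neighbour[OF False this] show ?thesis
      using ij False by (auto simp: hyper_wiener_mat_def scaled_mat_def edge_weight_def)
  qed (use ij in \<open>simp add: hyper_wiener_mat_def scaled_mat_def graph_dist_self\<close>)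
qed (auto simp: hyper_wiener_mat_def)

section \<open>Energy of the hyper-Wiener matrix\<close>
lemma eigensystem_scale:
  assumes "eigensystem n M lam u"
  shows "eigensystem n (\<lambda>i j. c * M i j) (\<lambda>k. c * lam k) u"
  using assms by (simp add: eigensystem_def sum_distrib_left mult.assoc)

lemma hyper_wiener_energy:
  assumes eig: "eigensystem n (scaled_mat n E) lam u" and "lonely_pairs n E < 1"
  shows "mat_energy (hyper_wiener_mat n E) = (\<Sum>k<n. \<bar>lam k\<bar>) / n * n powr (3 / 2)"
proof -
  have "mat_energy (hyper_wiener_mat n E) = (\<Sum>k<n. \<bar>sqrt n * lam k\<bar>)"
    unfolding hyper_wiener_mat_eq[OF assms(2)] by (rule mat_energy_eigensystem[OF eigensystem_scale[OF eig]])
  also have "\<dots> = sqrt n * (\<Sum>k<n. \<bar>lam k\<bar>)" by (simp add: abs_mult sum_distrib_left)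
  also have "\<dots> = (\<Sum>k<n. \<bar>lam k\<bar>) / n * n powr (3 / 2)"
  proof (cases "n = 0")
    case False
    then have "real n powr (3 / 2) = n * sqrt n"
      using powr_add[of n 1 "1/2"] by (simp add: powr_half_sqrt)
    then show ?thesis using False by simp
  qed simp
  finally show ?thesis .
qed

text \<open>
  Outside the rare event of a pair without common neighbour the energy is \<open>n powr (3 / 2)\<close> times the
  mean absolute eigenvalue of the scaled matrix. Convergence of the latter in \<open>L\<^sup>1\<close> gives convergence in
  probability by Markov's inequality, at a level \<open>\<epsilon> n\<close> that may tend to \<open>0\<close>.
\<close>
theorem corollary3p3:
  fixes p :: real
  assumes "0 < p" and "p < 1"
  shows "\<exists>\<epsilon> :: nat \<Rightarrow> real. \<epsilon> \<longlonglongrightarrow> 0 \<and>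
    holds_as p (\<lambda>n E. \<exists>r :: real. \<bar>r\<bar> \<le> \<epsilon> n \<and>
      mat_energy (hyper_wiener_mat n E) =
        (16 / (3 * pi) * sqrt (p * (1 - p)) + r) * real n powr (3 / 2))"
proof -
  define c where "c = 16 / (3 * pi) * sqrt (p * (1 - p))"
  have "\<exists>lam u. eigensystem n (scaled_mat n E) lam u" for n E
    by (rule eigensystem_exists) (auto simp: scaled_mat_def insert_commute)
  then obtain lam u where eig: "\<And>n E. eigensystem n (scaled_mat n E) (lam n E) (u n E)" by metis
  define X where "X n E = (\<Sum>k<n. \<bar>lam n E k\<bar>) / n - c" for n E
  define \<delta> where "\<delta> n = ER_expectation n p (\<lambda>E. \<bar>X n E\<bar>)" for n
  have \<delta>: "\<delta> \<longlonglongrightarrow> 0"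
    using mean_abs_eigenvalue_L1_limit[OF assms eig] unfolding \<delta>_def X_def c_def .
  have \<delta>0: "\<delta> n \<ge> 0" for n unfolding \<delta>_def by (intro integral_nonneg_AE) auto
  \<comment> \<open>Markov's inequality at the level \<open>sqrt (\<delta> n)\<close>; the second summand keeps \<open>\<epsilon> n\<close> positive if \<open>\<delta> n = 0\<close>.\<close>
  define \<epsilon> where "\<epsilon> n = sqrt (\<delta> n) + 1 / (real n + 1)" for n
  have \<epsilon>0: "\<epsilon> n > 0" for n unfolding \<epsilon>_def using \<delta>0[of n] by (intro add_nonneg_pos) auto
  have sqrt_\<delta>: "(\<lambda>n. sqrt (\<delta> n)) \<longlonglongrightarrow> 0" using tendsto_real_sqrt[OF \<delta>] by simp
  have "(\<lambda>n. 1 / (real n + 1)) \<longlonglongrightarrow> 0" by real_asymp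
  from tendsto_add[OF sqrt_\<delta> this] have \<epsilon>: "\<epsilon> \<longlonglongrightarrow> 0" unfolding \<epsilon>_def[abs_def] by simp
  define A where "A n = {E. \<exists>r :: real. \<bar>r\<bar> \<le> \<epsilon> n \<and> mat_energy (hyper_wiener_mat n E) = (c + r) * real n powr (3 / 2)}" for n
  have lower: "1 - (real n)\<^sup>2 * (1 - p\<^sup>2) ^ (n - 2) - sqrt (\<delta> n) \<le> measure_pmf.prob (erdos_renyi n p) (A n)" for n
  proof -
    \<comment> \<open>If \<open>E\<close> is not in \<open>A n\<close>, one of the two subtracted terms is at least \<open>1\<close>.\<close>
    have "1 - lonely_pairs n E - \<bar>X n E\<bar> / \<epsilon> n \<le> indicator (A n) E" for E
    proof (cases "lonely_pairs n E < 1 \<and> \<bar>X n E\<bar> \<le> \<epsilon> n")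
      case True
      then have "mat_energy (hyper_wiener_mat n E) = (c + X n E) * real n powr (3 / 2)"
        using hyper_wiener_energy[OF eig] by (simp add: X_def)
      then have "E \<in> A n" unfolding A_def using True by blast
      moreover have "0 \<le> \<bar>X n E\<bar> / \<epsilon> n" using \<epsilon>0[of n] by simp
      ultimately show ?thesis using lonely_pairs_nonneg[of n E] by simp
    next
      case False
      then have "1 \<le> lonely_pairs n E \<or> 1 \<le> \<bar>X n E\<bar> / \<epsilon> n" using \<epsilon>0[of n] by (auto simp: le_divide_eq)
      moreover have "0 \<le> \<bar>X n E\<bar> / \<epsilon> n" using \<epsilon>0[of n] by simp
      moreover have "(0 :: real) \<le> indicator (A n) E" by simp
      ultimately show ?thesis using lonely_pairs_nonneg[of n E] by linarith
    qed
    then have "ER_expectation n p (\<lambda>E. 1 - lonely_pairs n E - \<bar>X n E\<bar> / \<epsilon> n) \<le> ER_expectation n p (indicator (A n))"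
      by (intro integral_mono integrable_erdos_renyi)
    also have "\<dots> = measure_pmf.prob (erdos_renyi n p) (A n)" by simp
    also have "ER_expectation n p (\<lambda>E. 1 - lonely_pairs n E - \<bar>X n E\<bar> / \<epsilon> n) = 1 - ER_expectation n p (lonely_pairs n) - \<delta> n / \<epsilon> n"
      unfolding \<delta>_def by (simp add: Bochner_Integration.integral_diff)
    finally have "1 - ER_expectation n p (lonely_pairs n) - \<delta> n / \<epsilon> n \<le> measure_pmf.prob (erdos_renyi n p) (A n)" .
    moreover have "\<delta> n / \<epsilon> n \<le> sqrt (\<delta> n)"
    proof -
      have "\<delta> n = sqrt (\<delta> n) * sqrt (\<delta> n)" using \<delta>0 by simp
      also have "\<dots> \<le> sqrt (\<delta> n) * \<epsilon> n" using \<delta>0 unfolding \<epsilon>_def by (intro mult_left_mono) auto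
      finally show ?thesis using \<epsilon>0 by (simp add: divide_le_eq)
    qed
    moreover have "ER_expectation n p (lonely_pairs n) \<le> (real n)\<^sup>2 * (1 - p\<^sup>2) ^ (n - 2)"
      using assms by (intro lonely_pairs_expectation) auto
    ultimately show ?thesis by linarith
  qed
  define l where "l n = 1 - (real n)\<^sup>2 * (1 - p\<^sup>2) ^ (n - 2) - sqrt (\<delta> n)" for n
  have "l \<longlonglongrightarrow> 1 - 0 - 0" unfolding l_def[abs_def]
    by (intro tendsto_diff tendsto_const lonely_pairs_expectation_limit assms sqrt_\<delta>)
  then have "l \<longlonglongrightarrow> 1" by simp
  have "(\<lambda>n. measure_pmf.prob (erdos_renyi n p) (A n)) \<longlonglongrightarrow> 1"
  proof (rule tendsto_sandwich)
    show "l \<longlonglongrightarrow> 1" by fact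
    show "eventually (\<lambda>n. l n \<le> measure_pmf.prob (erdos_renyi n p) (A n)) sequentially"
      unfolding l_def by (intro always_eventually allI lower)
  qed (auto intro: tendsto_const)
  then show ?thesis using \<epsilon> unfolding holds_as_def A_def c_def by blast
qed

end
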